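(* Let $d\ge1$ be an integer and $\Delta,\sigma>0$. For symmetric positive semi-definite $d\times d$ matrices $\mathsf{K}_X,\mathsf{K}_Y$ define $$\mu(\mathsf{K}_X,\mathsf{K}_Y)=\inf_{P_Y\in\mathcal{P}(\mathsf{K}_Y)}\ \sup_{P_X\in\mathcal{P}(\mathsf{K}_X)} I(X;X+Y),$$ where $X\sim P_X$ and $Y\sim P_Y$ are independent random vectors in $\mathbb{R}^d$. (i) For every $\mathsf{K}_X$ and every positive definite $\mathsf{K}_Y$, an optimizing pair of distributions $(P_X,P_Y)$ for this inf-sup is given by $\big(\mathcal{N}(\mathbf{0},\mathsf{K}_X),\mathcal{N}(\mathbf{0},\mathsf{K}_Y)\big)$ (that is, $P_Y=\mathcal{N}(\mathbf{0},\mathsf{K}_Y)$ attains the infimum and, for this $P_Y$, $P_X=\mathcal{N}(\mathbf{0},\mathsf{K}_X)$ attains the supremum), which leads to $$\mu(\mathsf{K}_X,\mathsf{K}_Y)=\tfrac12\log\det\big(\mathsf{I}_d+\mathsf{K}_Y^{-1}\mathsf{K}_X\big).$$ (ii) Optimizing covariance matrices in $$\inf_{\mathsf{K}_Y\in\mathcal{K}_d(d\sigma^2)}\ \sup_{\mathsf{K}_X\in\mathcal{K}_d(d\Delta^2)}\ \mu(\mathsf{K}_X,\mathsf{K}_Y)$$ are given by $(\mathsf{K}_X,\mathsf{K}_Y)=(\Delta^2\mathsf{I}_d,\sigma^2\mathsf{I}_d)$ (that is, $\mathsf{K}_Y=\sigma^2\mathsf{I}_d$ attains the infimum and, for this $\mathsf{K}_Y$,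 $\mathsf{K}_X=\Delta^2\mathsf{I}_d$ attains the supremum).
   Context: $\log$ is the base-2 logarithm and mutual information $I(\cdot;\cdot)$ is in bits (with values in $[0,+\infty]$). $\mathsf{I}_d$ is the $d\times d$ identity matrix. $\mathcal{K}_d(a)$ is the set of $d\times d$ symmetric positive semi-definite matrices with trace at most $a$. $\mathcal{P}(\mathsf{K})$ is the set of probability distributions on $\mathbb{R}^d$ with mean $\mathbf{0}$ and covariance matrix $\mathsf{K}$. $\mathcal{N}(\mathbf{0},\mathsf{K})$ is the (possibly degenerate) Gaussian distribution with mean $\mathbf{0}$ and covariance $\mathsf{K}$. (Here $X$ is the input data and $Y$ the additive noise of the mechanism $M(X)=X+Y$.) *)

theory Defs
  imports "HOL-Probability.Probability"
begin

definition psd :: "real^'n^'n \<Rightarrow> bool" where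
  "psd K \<longleftrightarrow> transpose K = K \<and> (\<forall>x. 0 \<le> x \<bullet> (K *v x))"

definition pos_def :: "real^'n^'n \<Rightarrow> bool" where
  "pos_def K \<longleftrightarrow> transpose K = K \<and> (\<forall>x. x \<noteq> 0 \<longrightarrow> 0 < x \<bullet> (K *v x))"

definition psd_trace_le :: "real \<Rightarrow> (real^'n^'n) set" where
  "psd_trace_le a = {K. psd K \<and> trace K \<le> a}"

definition covariance_matrix :: "(real^'n) measure \<Rightarrow> real^'n^'n" where
  "covariance_matrix P =
     (\<chi> i j. \<integral>x. (x $ i - (\<integral>y. y \<partial>P) $ i) * (x $ j - (\<integral>y. y \<partial>P) $ j) \<partial>P)"

(* The integrability condition is needed because Bochner integrals of non-integrable
   functions are 0; it is equivalent to all entries of the covariance matrix being finite. *)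
definition centered_laws :: "real^'n^'n \<Rightarrow> (real^'n) measure set" where
  "centered_laws K = {P. prob_space P \<and> sets P = sets borel \<and>
     integrable P (\<lambda>x. (norm x)\<^sup>2) \<and> (\<integral>x. x \<partial>P) = 0 \<and> covariance_matrix P = K}"

definition std_gaussian :: "(real^'n) measure" where
  "std_gaussian = density lborel (\<lambda>z. ennreal (\<Prod>i\<in>UNIV. std_normal_density (z $ i)))"

(* The law of A Z with Z standard normal and A A^T = K. Such A exist for every positive
   semi-definite K (singular K included), and the law does not depend on the choice of A. *)
definition gaussian :: "real^'n^'n \<Rightarrow> (real^'n) measure" where
  "gaussian K = distr std_gaussian borel (\<lambda>z. (SOME A :: real^'n^'n. A ** transpose A = K) *v z)"

(* Relative entropy D(N || M) to base b > 1 of probability measures (same argument order as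
   KL_divergence). The library's KL_divergence is real-valued, so the value infinity has to
   be added: the negative part of the log-density is always N-integrable, hence if N << M,
   failure of integrability means exactly that the integral is infinite. *)
definition KL_ext :: "real \<Rightarrow> 'a measure \<Rightarrow> 'a measure \<Rightarrow> ereal" where
  "KL_ext b M N =
     (if absolutely_continuous M N \<and> integrable N (entropy_density b M N)
      then ereal (KL_divergence b M N) else \<infinity>)"

(* In bits. On a probability space this is the library's mutual_information whenever finite. *)
definition mutual_info ::
    "'o measure \<Rightarrow> ('o \<Rightarrow> 'a::topological_space) \<Rightarrow> ('o \<Rightarrow> 'b::topological_space) \<Rightarrow> ereal" where
  "mutual_info M X Y =
     KL_ext 2 (distr M borel X \<Otimes>\<^sub>M distr M borel Y)
              (distr M (borel \<Otimes>\<^sub>M borel) (\<lambda>\<omega>. (X \<omega>, Y \<omega>)))"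

(* I(X; X + Y) for independent X ~ PX and Y ~ PY, realised as the coordinates of the product
   space; see additive_info_indep for arbitrary independent X and Y. *)
definition additive_info :: "(real^'n) measure \<Rightarrow> (real^'n) measure \<Rightarrow> ereal" where
  "additive_info PX PY = mutual_info (PX \<Otimes>\<^sub>M PY) fst (\<lambda>(x, y). x + y)"

lemma additive_info_indep:
  fixes X Y :: "'o \<Rightarrow> real^'n"
  assumes "prob_space M" "prob_space.indep_var M borel X borel Y"
  shows "additive_info (distr M borel X) (distr M borel Y) = mutual_info M X (\<lambda>\<omega>. X \<omega> + Y \<omega>)"
proof -
  interpret prob_space M by fact
  have [measurable]: "X \<in> borel_measurable M" "Y \<in> borel_measurable M"
    and *: "distr M borel X \<Otimes>\<^sub>M distr M borel Y =
      distr M (borel \<Otimes>\<^sub>M borel) (\<lambda>\<omega>. (X \<omega>, Y \<omega>))"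
    using assms(2) by (auto simp: indep_var_distribution_eq)
  show ?thesis
    unfolding additive_info_def mutual_info_def * by (simp add: distr_distr comp_def)
qed

definition mu :: "real^'n^'n \<Rightarrow> real^'n^'n \<Rightarrow> ereal" where
  "mu KX KY = (INF PY\<in>centered_laws KY. SUP PX\<in>centered_laws KX. additive_info PX PY)"

end

theory Submission
  imports Defs
begin

text \<open>
  Write \<open>p\<^bsub>K\<^esub>\<close> for the density of \<open>N(0, K)\<close>, and let \<open>S = X + Y\<close>. For reference covariances
  \<open>K\<^sub>X\<close>, \<open>K\<^sub>Y\<close> put \<open>\<Sigma> = K\<^sub>X + K\<^sub>Y\<close> and \<open>f (x, s) = p\<^bsub>K\<^sub>Y\<^esub> (s - x) / p\<^bsub>\<Sigma>\<^esub> (s)\<close>. Since \<open>log f\<close> is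
  quadratic, its expectation depends only on the covariances of \<open>X\<close> and \<open>Y\<close>.
  If \<open>Y\<close> is \<open>N(0, K\<^sub>Y)\<close>, Gibbs' inequality for the output density against \<open>p\<^bsub>\<Sigma>\<^esub>\<close> yields
  \<open>I(X; S) \<le> E (log f (X, S))\<close> for every \<open>X\<close>. If \<open>X\<close> is \<open>N(0, K\<^sub>X)\<close>, then \<open>f (\<cdot>, s)\<close> integrates to 1
  against the law of \<open>X\<close> for every \<open>s\<close>, and the Donsker-Varadhan bound yields
  \<open>I(X; S) \<ge> E (log f (X, S))\<close> for every \<open>Y\<close>, even one without a density.
  Part (i) takes as reference the covariances themselves. In part (ii) the scalar reference makes
  \<open>E (log f (X, S))\<close> affine in the two traces, which handles all competitors, singular noise
  covariances included.
\<close>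

section \<open>Lebesgue measure under linear maps\<close>

text \<open>Uniqueness of Haar measure by Fubini. In the double integral of
  \<open>f x * g (x + y)\<close>, translating \<open>y\<close> gives the left side; translating
  \<open>x\<close> by \<open>- y\<close> under \<open>\<mu>\<close> and then reflecting
  \<open>y\<close> gives the right side. Cross-multiplying avoids dividing by integrals that may be
  zero or infinite.\<close>

lemma translation_invariant_proportional_lborel:
  fixes \<mu> :: "'a::euclidean_space measure" and f g :: "'a \<Rightarrow> ennreal"
  assumes "sigma_finite_measure \<mu>" and [measurable_cong]: "sets \<mu> = sets borel"
    and inv: "\<And>a h. h \<in> borel_measurable borel \<Longrightarrow> (\<integral>\<^sup>+x. h (a + x) \<partial>\<mu>) = (\<integral>\<^sup>+x. h x \<partial>\<mu>)"
    and [measurable]: "f \<in> borel_measurable borel" "g \<in> borel_measurable borel"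
  shows "(\<integral>\<^sup>+x. f x \<partial>\<mu>) * (\<integral>\<^sup>+x. g x \<partial>lborel) = (\<integral>\<^sup>+x. g x \<partial>\<mu>) * (\<integral>\<^sup>+x. f x \<partial>lborel)"
proof -
  interpret \<mu>: sigma_finite_measure \<mu> by fact
  interpret P: pair_sigma_finite \<mu> "lborel :: 'a measure" ..
  \<comment> \<open>With \<open>c = 1\<close> this is a translation, with \<open>c = -1\<close> the
    reflection of \<open>y\<close> to \<open>x - y\<close>; both preserve Lebesgue measure.\<close>
  have shift: "(\<integral>\<^sup>+y. h (x + c *\<^sub>R y) \<partial>lborel) = (\<integral>\<^sup>+y. h y \<partial>lborel)"
    if [measurable]: "h \<in> borel_measurable borel" and "\<bar>c\<bar> = 1" for h x c
    using \<open>\<bar>c\<bar> = 1\<close> by (subst (2) lborel_affine[of c x]) (auto simp: nn_integral_density nn_integral_distr)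
  have "(\<integral>\<^sup>+x. f x \<partial>\<mu>) * (\<integral>\<^sup>+x. g x \<partial>lborel) = (\<integral>\<^sup>+x. f x * (\<integral>\<^sup>+y. g y \<partial>lborel) \<partial>\<mu>)"
    by (simp add: nn_integral_multc)
  also have "\<dots> = (\<integral>\<^sup>+x. \<integral>\<^sup>+y. f x * g (x + y) \<partial>lborel \<partial>\<mu>)"
    using shift[of g 1] by (simp add: nn_integral_cmult)
  also have "\<dots> = (\<integral>\<^sup>+y. \<integral>\<^sup>+x. f x * g (x + y) \<partial>\<mu> \<partial>lborel)"
    by (rule P.Fubini'[symmetric]) measurable
  also have "\<dots> = (\<integral>\<^sup>+y. \<integral>\<^sup>+x. f (x - y) * g x \<partial>\<mu> \<partial>lborel)"
  proof (rule nn_integral_cong)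
    fix y show "(\<integral>\<^sup>+x. f x * g (x + y) \<partial>\<mu>) = (\<integral>\<^sup>+x. f (x - y) * g x \<partial>\<mu>)"
      using inv[of "\<lambda>x. f x * g (x + y)" "- y"] by simp
  qed
  also have "\<dots> = (\<integral>\<^sup>+x. \<integral>\<^sup>+y. f (x - y) * g x \<partial>lborel \<partial>\<mu>)"
    by (rule P.Fubini') measurable
  also have "\<dots> = (\<integral>\<^sup>+x. (\<integral>\<^sup>+y. f y \<partial>lborel) * g x \<partial>\<mu>)"
    using shift[of f "-1"] by (simp add: nn_integral_multc)
  also have "\<dots> = (\<integral>\<^sup>+x. g x \<partial>\<mu>) * (\<integral>\<^sup>+x. f x \<partial>lborel)"
    by (simp add: nn_integral_cmult nn_integral_multc mult.commute)
  finally show ?thesis .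
qed

text \<open>The image of Lebesgue measure under \<open>T\<close> is again translation invariant,
  because shifting \<open>T x\<close> by \<open>a\<close> is shifting \<open>x\<close> by
  \<open>inv T a\<close>; hence it is a multiple of Lebesgue measure. The unit ball determines the
  factor, and an orthogonal \<open>T\<close> preserves that ball. The factor is tied to the
  determinant only in \<open>nn_integral_lborel_matrix\<close>.\<close>

lemma nn_integral_lborel_linear:
  fixes T :: "'a::euclidean_space \<Rightarrow> 'a"
  assumes T: "linear T" "inj T"
  obtains c :: real where "0 < c"
    "\<And>f :: 'a \<Rightarrow> ennreal. f \<in> borel_measurable borel \<Longrightarrow>
       (\<integral>\<^sup>+x. f (T x) \<partial>lborel) = ennreal c * (\<integral>\<^sup>+x. f x \<partial>lborel)"
    "orthogonal_transformation T \<Longrightarrow> c = 1"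
proof -
  have [measurable]: "T \<in> borel_measurable borel"
    using T by (intro borel_measurable_continuous_onI linear_continuous_on linear_conv_bounded_linear[THEN iffD1])
  have "surj T" using T by (simp add: linear_injective_imp_surjective)
  then have TT: "T (inv T y) = y" for y by (rule surj_f_inv_f)
  have [measurable]: "inv T \<in> borel_measurable borel"
    using inj_linear_imp_inv_linear[OF T] by (intro borel_measurable_continuous_onI linear_continuous_on linear_conv_bounded_linear[THEN iffD1])
  define \<mu> where "\<mu> = distr lborel borel T"
  have [measurable_cong, simp]: "sets \<mu> = sets borel" by (simp add: \<mu>_def)
  have sf: "sigma_finite_measure \<mu>"
  proof
    \<comment> \<open>Balls pulled back along \<open>inv T\<close> exhaust the space; pulling them
      back further along \<open>T\<close> returns the balls, which have finite volume.\<close>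
    let ?A = "range (\<lambda>n. inv T -` ball 0 (real n))"
    have 1: "emeasure \<mu> (inv T -` ball 0 (real n)) \<noteq> \<infinity>" for n
    proof -
      have "T -` inv T -` ball 0 (real n) = ball 0 (real n)"
        using T(2) by auto
      then have "emeasure \<mu> (inv T -` ball 0 (real n)) = emeasure lborel (ball (0::'a) (real n))"
        unfolding \<mu>_def by (subst emeasure_distr) (use measurable_sets_borel[of "inv T" borel "ball 0 (real n)"] in auto)
      then show ?thesis
        using emeasure_bounded_finite[of "ball (0::'a) (real n)"] by (auto simp: less_top)
    qed
    have 3: "inv T -` ball 0 r \<in> sets borel" for r
      using measurable_sets_borel[of "inv T" borel "ball 0 r"] by simp
    have 2: "\<Union> ?A = space \<mu>"
      using reals_Archimedean2 by (auto simp: \<mu>_def)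
    show "\<exists>A. countable A \<and> A \<subseteq> sets \<mu> \<and> \<Union> A = space \<mu> \<and> (\<forall>a\<in>A. emeasure \<mu> a \<noteq> \<infinity>)"
      by (intro exI[of _ ?A] conjI 2) (use 1 3 in auto)
  qed
  have \<mu>: "(\<integral>\<^sup>+x. f x \<partial>\<mu>) = (\<integral>\<^sup>+x. f (T x) \<partial>lborel)" if [measurable]: "f \<in> borel_measurable borel" for f
    by (simp add: \<mu>_def nn_integral_distr)
  have inv: "(\<integral>\<^sup>+x. h (a + x) \<partial>\<mu>) = (\<integral>\<^sup>+x. h x \<partial>\<mu>)" if [measurable]: "h \<in> borel_measurable borel" for a h
  proof -
    have "(\<integral>\<^sup>+x. h (a + x) \<partial>\<mu>) = (\<integral>\<^sup>+x. h (T (inv T a + x)) \<partial>lborel)"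
      by (simp add: \<mu> linear_add[OF T(1)] TT)
    also have "\<dots> = (\<integral>\<^sup>+x. h (T x) \<partial>distr lborel borel ((+) (inv T a)))"
      by (simp add: nn_integral_distr)
    finally show ?thesis by (simp add: lborel_distr_plus \<mu>)
  qed
  let ?B = "ball (0::'a) 1"
  have B: "(indicator ?B :: 'a \<Rightarrow> ennreal) \<in> borel_measurable borel"
    by (rule borel_measurable_indicator) simp
  define b where "b = measure lborel ?B"
  define c where "c = measure lborel (T -` ?B) / b"
  have b: "emeasure lborel ?B = ennreal b" "0 < b"
    by (auto simp: b_def emeasure_ball content_ball unit_ball_vol_pos)
  have "bounded (inv T ` ?B)"
    by (intro bounded_linear_image bounded_ball inj_linear_imp_inv_linear[OF T] linear_conv_bounded_linear[THEN iffD1])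
  moreover have "inv T ` ?B = T -` ?B"
    using bij_vimage_eq_inv_image[of T ?B] T(2) \<open>surj T\<close> by (simp add: bij_def)
  ultimately have TB: "emeasure lborel (T -` ?B) = ennreal (measure lborel (T -` ?B))"
    using emeasure_bounded_finite[of "T -` ?B"] by (auto intro!: emeasure_eq_ennreal_measure simp: less_top)
  have scale: "(\<integral>\<^sup>+x. f (T x) \<partial>lborel) = ennreal c * (\<integral>\<^sup>+x. f x \<partial>lborel)"
    if [measurable]: "f \<in> borel_measurable borel" for f :: "'a \<Rightarrow> ennreal"
  proof -
    have "(\<integral>\<^sup>+x. indicator ?B (T x) \<partial>lborel) = (\<integral>\<^sup>+x. indicator (T -` ?B) x \<partial>lborel)"
      by (intro nn_integral_cong) (auto simp: indicator_def)
    also have "\<dots> = ennreal (measure lborel (T -` ?B))"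
      using measurable_sets_borel[of T borel ?B] by (simp add: TB)
    finally have "(\<integral>\<^sup>+x. indicator ?B x \<partial>\<mu>) = ennreal (measure lborel (T -` ?B))"
      by (subst \<mu>[OF B])
    moreover have "(\<integral>\<^sup>+x. f x \<partial>\<mu>) * (\<integral>\<^sup>+x. indicator ?B x \<partial>lborel) = (\<integral>\<^sup>+x. indicator ?B x \<partial>\<mu>) * (\<integral>\<^sup>+x. f x \<partial>lborel)"
      by (rule translation_invariant_proportional_lborel[OF sf _ inv that B]) auto
    ultimately have "(\<integral>\<^sup>+x. f (T x) \<partial>lborel) * ennreal b = ennreal (measure lborel (T -` ?B)) * (\<integral>\<^sup>+x. f x \<partial>lborel)"
      by (simp add: \<mu> b)
    then have "(\<integral>\<^sup>+x. f (T x) \<partial>lborel) * ennreal b * ennreal (1 / b) =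
        ennreal (measure lborel (T -` ?B)) * ennreal (1 / b) * (\<integral>\<^sup>+x. f x \<partial>lborel)"
      by (simp add: mult_ac)
    then show ?thesis
      using b(2) by (simp add: c_def mult.assoc ennreal_mult''[symmetric] ennreal_mult'[symmetric])
  qed
  show ?thesis
  proof (rule that[OF _ scale])
    \<comment> \<open>A factor 0 would give measure 0 to the whole space, whose Lebesgue measure is
      infinite.\<close>
    have "c \<noteq> 0"
    proof
      assume "c = 0"
      then show False using scale[of "\<lambda>_. 1"] by simp
    qed
    then show "0 < c" using b by (simp add: c_def less_le)
    assume "orthogonal_transformation T"
    then have "T -` ?B = ?B" by (auto simp: orthogonal_transformation_norm)
    then show "c = 1" using b by (simp add: c_def b_def)
  qed
qed

lemma nn_integral_lborel_orthogonal:
  fixes T :: "'a::euclidean_space \<Rightarrow> 'a"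
  assumes "orthogonal_transformation T" "f \<in> borel_measurable borel"
  shows "(\<integral>\<^sup>+x. f (T x) \<partial>lborel) = (\<integral>\<^sup>+x. f x \<partial>lborel)"
proof -
  have "linear T" "inj T"
    using assms(1) by (auto simp: orthogonal_transformation_linear orthogonal_transformation_inj)
  then obtain c :: real where c: "\<And>f :: 'a \<Rightarrow> ennreal. f \<in> borel_measurable borel \<Longrightarrow>
       (\<integral>\<^sup>+x. f (T x) \<partial>lborel) = ennreal c * (\<integral>\<^sup>+x. f x \<partial>lborel)"
    "orthogonal_transformation T \<Longrightarrow> c = 1"
    by (rule nn_integral_lborel_linear) auto
  with assms show ?thesis by simp
qed

text \<open>Change of variables by induction over elementary matrices: the scaling factors multiply
  under products, a zero row makes the determinant vanish, and there remain diagonal scalings,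
  coordinate swaps (which are orthogonal) and shears.\<close>

lemma nn_integral_lborel_matrix:
  fixes A :: "real^'n^'n"
  assumes "det A \<noteq> 0" "f \<in> borel_measurable borel"
  shows "(\<integral>\<^sup>+x. f x \<partial>lborel) = ennreal \<bar>det A\<bar> * (\<integral>\<^sup>+x. f (A *v x) \<partial>lborel)"
proof -
  define P where "P A \<longleftrightarrow> (det A \<noteq> 0 \<longrightarrow> (\<forall>f\<in>borel_measurable borel.
    (\<integral>\<^sup>+x. f x \<partial>lborel) = ennreal \<bar>det A\<bar> * (\<integral>\<^sup>+x. f (A *v x) \<partial>lborel)))" for A :: "real^'n^'n"
  have [measurable]: "(*v) A \<in> borel_measurable borel" for A :: "real^'n^'n"
    by (intro borel_measurable_continuous_onI linear_continuous_on matrix_vector_mul_bounded_linear)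
  have orth: "P W" if "orthogonal_transformation ((*v) W)" for W
  proof -
    have "\<bar>det W\<bar> = 1"
      using that det_orthogonal_matrix[of W] by (auto simp: orthogonal_transformation_matrix)
    with nn_integral_lborel_orthogonal[OF that] show ?thesis by (simp add: P_def)
  qed
  have "P A"
  proof (rule induct_matrix_elementary[of P])
    fix A B :: "real^'n^'n" assume 1: "P A" "P B"
    show "P (A ** B)"
      unfolding P_def
    proof safe
      fix f :: "real^'n \<Rightarrow> ennreal" assume [measurable]: "f \<in> borel_measurable borel" and "det (A ** B) \<noteq> 0"
      then have d: "det A \<noteq> 0" "det B \<noteq> 0" by (auto simp: det_mul)
      have "(\<integral>\<^sup>+x. f x \<partial>lborel) = ennreal \<bar>det A\<bar> * (\<integral>\<^sup>+x. f (A *v x) \<partial>lborel)"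
        by (rule 1(1)[unfolded P_def, rule_format, OF d(1)]) measurable
      also have "(\<integral>\<^sup>+x. f (A *v x) \<partial>lborel) = ennreal \<bar>det B\<bar> * (\<integral>\<^sup>+x. f (A *v (B *v x)) \<partial>lborel)"
        by (rule 1(2)[unfolded P_def, rule_format, OF d(2)]) measurable
      finally show "(\<integral>\<^sup>+x. f x \<partial>lborel) = ennreal \<bar>det (A ** B)\<bar> * (\<integral>\<^sup>+x. f ((A ** B) *v x) \<partial>lborel)"
        by (simp add: det_mul abs_mult ennreal_mult mult.assoc matrix_vector_mul_assoc)
    qed
  next
    fix A :: "real^'n^'n" and i :: 'n assume "row i A = 0"
    then show "P A" by (auto simp: P_def det_zero_row)
  next
    fix A :: "real^'n^'n" assume 3: "A $ i $ j = 0" if "i \<noteq> j" for i j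
    have det: "det A = (\<Prod>i\<in>UNIV. A $ i $ i)" using 3 by (rule det_diagonal)
    \<comment> \<open>The diagonal entries are indexed by basis vectors, as the coordinatewise
      scaling rule \<open>lborel_affine_euclidean\<close> expects.\<close>
    define c where "c j = j \<bullet> (A *v j)" for j
    have c: "c (axis i 1) = A $ i $ i" for i
      by (simp add: c_def inner_axis' matrix_vector_mult_basis column_def)
    have Av: "A *v x = 0 + (\<Sum>j\<in>Basis. (c j * (x \<bullet> j)) *\<^sub>R j)" for x
    proof (rule euclidean_eqI)
      fix b :: "real^'n" assume "b \<in> Basis"
      then obtain i where b: "b = axis i 1" by (auto simp: Basis_vec_def)
      have "(A *v x) $ i = A $ i $ i * x $ i"
        using 3 by (simp add: matrix_vector_mult_def sum.remove[of UNIV i])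
      then have "(A *v x) \<bullet> b = c b * (x \<bullet> b)"
        by (simp add: b c inner_axis)
      then show "(A *v x) \<bullet> b = (0 + (\<Sum>j\<in>Basis. (c j * (x \<bullet> j)) *\<^sub>R j)) \<bullet> b"
        using \<open>b \<in> Basis\<close> by simp
    qed
    have Basis: "Basis = range (\<lambda>i. axis i 1 :: real^'n)" by (auto simp: Basis_vec_def)
    have prod: "(\<Prod>j\<in>Basis. \<bar>c j\<bar>) = \<bar>det A\<bar>"
      unfolding Basis det abs_prod by (subst prod.reindex) (auto simp: inj_on_def axis_eq_axis c)
    show "P A"
      unfolding P_def
    proof safe
      fix f :: "real^'n \<Rightarrow> ennreal" assume [measurable]: "f \<in> borel_measurable borel" and "det A \<noteq> 0"
      then have "c j \<noteq> 0" if "j \<in> Basis" for j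
        using that unfolding det Basis by (auto simp: c)
      from lborel_affine_euclidean[of c 0, OF this]
      have "lborel = density (distr lborel borel ((*v) A)) (\<lambda>_. ennreal \<bar>det A\<bar>)"
        unfolding Av[symmetric] prod by simp
      then have "(\<integral>\<^sup>+x. f x \<partial>lborel) = (\<integral>\<^sup>+x. f x \<partial>density (distr lborel borel ((*v) A)) (\<lambda>_. ennreal \<bar>det A\<bar>))"
        by (rule arg_cong)
      then show "(\<integral>\<^sup>+x. f x \<partial>lborel) = ennreal \<bar>det A\<bar> * (\<integral>\<^sup>+x. f (A *v x) \<partial>lborel)"
        by (simp add: nn_integral_density nn_integral_distr nn_integral_cmult)
    qed
  next
    fix m n :: 'n
    let ?W = "\<chi> i j. mat 1 $ i $ Transposition.transpose m n j :: real^'n^'n"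
    have W: "(?W *v x) $ i = x $ Transposition.transpose m n i" for x i
    proof -
      have "(?W *v x) $ i = (\<Sum>j\<in>UNIV. if j = Transposition.transpose m n i then x $ j else 0)"
        unfolding matrix_vector_mult_def vec_lambda_beta
        by (intro sum.cong refl) (auto simp: mat_def)
      then show ?thesis by simp
    qed
    have "orthogonal_transformation ((*v) ?W)"
      unfolding orthogonal_transformation_def
    proof (intro conjI allI)
      fix v w :: "real^'n"
      have "(?W *v v) \<bullet> (?W *v w) = (\<Sum>i\<in>UNIV. (v $ Transposition.transpose m n i) * (w $ Transposition.transpose m n i))"
        by (simp add: inner_vec_def W)
      also have "\<dots> = v \<bullet> w"
        unfolding inner_vec_def inner_real_def
        by (rule sum.reindex_bij_betw[of "Transposition.transpose m n" UNIV UNIV "\<lambda>i. v $ i * w $ i", simplified])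
      finally show "(?W *v v) \<bullet> (?W *v w) = v \<bullet> w" .
    qed simp
    then show "P ?W" by (rule orth)
  next
    fix m n :: 'n and c :: real assume 5: "m \<noteq> n"
    define S where "S = (\<chi> i j. if i = m \<and> j = n then c else of_bool (i = j) :: real^'n^'n)"
    define D where "D = (\<chi> i j. if i = j then (if i = m then - 1 else 1) else 0 :: real^'n^'n)"
    have Sv: "(S *v x) $ i = x $ i + (if i = m then c * x $ n else 0)" for x i
      using 5 by (simp add: S_def matrix_vector_mult_def sum.remove[of UNIV i] sum.remove[of "UNIV - {m}" n])
    have Dv: "(D *v x) $ i = (if i = m then - x $ i else x $ i)" for x i
      by (simp add: D_def matrix_vector_mult_def sum.remove[of UNIV i])
    have "orthogonal_transformation ((*v) D)"
      unfolding orthogonal_transformation_def by (auto simp: inner_vec_def Dv intro!: sum.cong)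
    then have PD: "(\<integral>\<^sup>+x. f (D *v x) \<partial>lborel) = (\<integral>\<^sup>+x. f x \<partial>lborel)" if "f \<in> borel_measurable borel" for f
      using that by (rule nn_integral_lborel_orthogonal)
    \<comment> \<open>\<open>S\<close> is conjugate to its inverse by a reflection, so its scaling factor squares to 1.\<close>
    have DSDS: "D *v (S *v (D *v (S *v x))) = x" for x
      using 5 by (simp add: vec_eq_iff Sv Dv)
    then have "D ** (S ** (D ** S)) = mat 1"
      unfolding matrix_eq by (simp flip: matrix_vector_mul_assoc)
    then have "det D * (det S * (det D * det S)) = 1"
      by (simp flip: det_mul)
    then have "(det D)\<^sup>2 * (det S)\<^sup>2 = 1" by (simp add: power2_eq_square mult_ac)
    moreover have "(det D)\<^sup>2 = 1"
      using \<open>orthogonal_transformation ((*v) D)\<close> det_orthogonal_matrix[of D]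
      by (auto simp: orthogonal_transformation_matrix)
    ultimately have det: "\<bar>det S\<bar> = 1" by (simp add: abs_square_eq_1 power2_eq_1_iff)
    have "inj ((*v) S)" by (rule injI) (metis DSDS)
    then obtain k where k: "0 < k"
      "\<And>f :: real^'n \<Rightarrow> ennreal. f \<in> borel_measurable borel \<Longrightarrow>
         (\<integral>\<^sup>+x. f (S *v x) \<partial>lborel) = ennreal k * (\<integral>\<^sup>+x. f x \<partial>lborel)"
      using nn_integral_lborel_linear[OF matrix_vector_mul_linear] by metis
    have kk: "(\<integral>\<^sup>+x. f x \<partial>lborel) = ennreal (k * k) * (\<integral>\<^sup>+x. f x \<partial>lborel)"
      if [measurable]: "f \<in> borel_measurable borel" for f :: "real^'n \<Rightarrow> ennreal"
    proof -
      have "(\<integral>\<^sup>+x. f x \<partial>lborel) = (\<integral>\<^sup>+x. f (D *v (S *v (D *v (S *v x)))) \<partial>lborel)"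
        by (simp only: DSDS)
      also have "\<dots> = ennreal k * (\<integral>\<^sup>+x. f (D *v (S *v (D *v x))) \<partial>lborel)"
        by (rule k) measurable
      also have "\<dots> = ennreal k * (\<integral>\<^sup>+x. f (D *v (S *v x)) \<partial>lborel)"
        by (subst PD) auto
      also have "\<dots> = ennreal k * (ennreal k * (\<integral>\<^sup>+x. f (D *v x) \<partial>lborel))"
        by (subst k(2)) auto
      also have "\<dots> = ennreal (k * k) * (\<integral>\<^sup>+x. f x \<partial>lborel)"
        using k(1) by (subst PD) (auto simp: ennreal_mult mult.assoc)
      finally show ?thesis .
    qed
    \<comment> \<open>Testing on the unit ball, whose volume is finite and positive, forces
      \<open>k * k = 1\<close>.\<close>
    have "indicator (ball (0::real^'n) 1) \<in> borel_measurable borel"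
      by (rule borel_measurable_indicator) simp
    from kk[OF this] have "ennreal (unit_ball_vol (real CARD('n))) = ennreal (k * k * unit_ball_vol (real CARD('n)))"
      using k(1) by (simp add: emeasure_ball ennreal_mult)
    then have "k * k = 1"
      using k(1) by (simp add: less_imp_neq[OF unit_ball_vol_pos, symmetric])
    then have "k = 1" using k(1) by (auto simp: square_eq_1_iff)
    then have "P S" unfolding P_def det by (auto simp: k(2))
    then show "P (\<chi> i j. if i = m \<and> j = n then c else of_bool (i = j))" by (simp add: S_def)
  qed
  then show ?thesis using assms unfolding P_def by blast
qed

section \<open>The standard Gaussian measure and orthogonal maps\<close>

text \<open>The density is written through the norm, so that invariance under orthogonal maps is
  visible, and over any Euclidean space, so that the product space carrying two independent
  Gaussians is covered.\<close>

definition std_normal :: "'a::euclidean_space measure" where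
  "std_normal = density lborel (\<lambda>z. ennreal (exp (- (norm z)\<^sup>2 / 2) / sqrt (2 * pi) ^ DIM('a)))"

lemma sets_std_normal [simp, measurable_cong]: "sets std_normal = sets borel"
  by (simp add: std_normal_def)

lemma space_std_normal [simp]: "space std_normal = UNIV"
  by (simp add: std_normal_def)

lemma prod_std_normal_density:
  fixes z :: "'a::euclidean_space"
  shows "(\<Prod>b\<in>Basis. std_normal_density (z \<bullet> b)) = exp (- (norm z)\<^sup>2 / 2) / sqrt (2 * pi) ^ DIM('a)"
proof -
  have "(norm z)\<^sup>2 = (\<Sum>b\<in>Basis. (z \<bullet> b)\<^sup>2)"
    unfolding power2_norm_eq_inner by (subst euclidean_inner) (simp add: power2_eq_square)
  then show ?thesis
    by (simp add: std_normal_density_def prod_dividef exp_sum[symmetric] sum_negf sum_divide_distrib)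
qed

lemma std_gaussian_eq_std_normal: "(std_gaussian :: (real^'n) measure) = std_normal"
proof -
  have "(\<Prod>i\<in>UNIV. std_normal_density (z $ i)) = (\<Prod>b\<in>Basis. std_normal_density (z \<bullet> b))" for z :: "real^'n"
  proof -
    have Basis: "Basis = range (\<lambda>i. axis i 1 :: real^'n)" by (auto simp: Basis_vec_def)
    show ?thesis
      unfolding Basis by (subst prod.reindex) (auto simp: inj_on_def axis_eq_axis inner_axis)
  qed
  then show ?thesis
    unfolding std_gaussian_def std_normal_def prod_std_normal_density by simp
qed

lemma nn_integral_std_normal_prod:
  fixes f :: "'a::euclidean_space \<Rightarrow> real \<Rightarrow> real"
  assumes [measurable]: "\<And>b. b \<in> Basis \<Longrightarrow> f b \<in> borel_measurable borel"
    and nn: "\<And>b x. b \<in> Basis \<Longrightarrow> 0 \<le> f b x"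
  shows "(\<integral>\<^sup>+z. ennreal (\<Prod>b\<in>Basis. f b (z \<bullet> b)) \<partial>std_normal) =
    (\<Prod>b\<in>Basis. \<integral>\<^sup>+x. ennreal (std_normal_density x * f b x) \<partial>lborel)"
proof -
  have "(\<integral>\<^sup>+z. ennreal (\<Prod>b\<in>Basis. f b (z \<bullet> b)) \<partial>std_normal) =
      (\<integral>\<^sup>+z. (\<Prod>b\<in>Basis. ennreal (std_normal_density (z \<bullet> b) * f b (z \<bullet> b))) \<partial>lborel)"
    unfolding std_normal_def prod_std_normal_density[symmetric]
    by (subst nn_integral_density)
       (auto simp: nn prod_nonneg prod_ennreal ennreal_mult[symmetric] prod.distrib[symmetric] intro!: nn_integral_cong)
  also have "\<dots> = (\<Prod>b\<in>Basis. \<integral>\<^sup>+x. ennreal (std_normal_density x * f b x) \<partial>lborel)"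
    by (rule nn_integral_lborel_prod) (auto simp: nn)
  finally show ?thesis .
qed

lemma nn_integral_std_normal_density: "(\<integral>\<^sup>+x. ennreal (std_normal_density x) \<partial>lborel) = 1"
  using prob_space.emeasure_space_1[OF prob_space_normal_density[of 1 0]]
  by (simp add: emeasure_density)

lemma prob_space_std_normal: "prob_space (std_normal :: 'a::euclidean_space measure)"
proof
  show "emeasure (std_normal :: 'a measure) (space std_normal) = 1"
    using nn_integral_std_normal_prod[where 'a='a and f="\<lambda>_ _. 1"]
    by (simp add: nn_integral_std_normal_density)
qed

text \<open>The density depends only on the norm, and Lebesgue measure is itself invariant under
  orthogonal maps.\<close>

lemma distr_std_normal_orthogonal:
  fixes T :: "'a::euclidean_space \<Rightarrow> 'a"
  assumes T: "orthogonal_transformation T"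
  shows "distr std_normal borel T = std_normal"
proof (rule measure_eqI)
  have [measurable]: "T \<in> borel_measurable borel"
    using T by (intro borel_measurable_continuous_onI linear_continuous_on linear_conv_bounded_linear[THEN iffD1])
      (rule orthogonal_transformation_linear)
  fix A assume "A \<in> sets (distr std_normal borel T)"
  then have [measurable]: "A \<in> sets borel" by simp
  let ?h = "\<lambda>z::'a. ennreal (exp (- (norm z)\<^sup>2 / 2) / sqrt (2 * pi) ^ DIM('a))"
  have "emeasure (distr std_normal borel T) A = (\<integral>\<^sup>+z. ?h z * indicator (T -` A) z \<partial>lborel)"
    using measurable_sets_borel[of T borel A]
    by (subst emeasure_distr) (auto simp: std_normal_def emeasure_density)
  also have "\<dots> = (\<integral>\<^sup>+z. ?h (T z) * indicator A (T z) \<partial>lborel)"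
    by (intro nn_integral_cong) (simp add: orthogonal_transformation_norm[OF T] indicator_def)
  also have "\<dots> = (\<integral>\<^sup>+z. ?h z * indicator A z \<partial>lborel)"
    by (rule nn_integral_lborel_orthogonal[OF T]) measurable
  finally show "emeasure (distr std_normal borel T) A = emeasure std_normal A"
    by (simp add: std_normal_def emeasure_density)
qed simp

text \<open>Squared norms add on a product space, so two independent standard Gaussian vectors form
  a single one. Sums of independent Gaussians thereby become linear images of one standard
  Gaussian.\<close>

lemma std_normal_pair:
  "(std_normal :: 'a::euclidean_space measure) \<Otimes>\<^sub>M (std_normal :: 'b::euclidean_space measure) = std_normal"
proof -
  interpret prob_space "std_normal :: 'b measure" by (rule prob_space_std_normal)
  have "(std_normal :: 'a measure) \<Otimes>\<^sub>M (std_normal :: 'b measure) =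
    density (lborel \<Otimes>\<^sub>M lborel) (\<lambda>(x, y). ennreal (exp (- (norm x)\<^sup>2 / 2) / sqrt (2 * pi) ^ DIM('a)) *
      ennreal (exp (- (norm y)\<^sup>2 / 2) / sqrt (2 * pi) ^ DIM('b)))"
    unfolding std_normal_def
    by (rule pair_measure_density) (auto intro: lborel.sigma_finite_measure_axioms sigma_finite_measure_axioms[unfolded std_normal_def, simplified])
  also have "\<dots> = std_normal"
    unfolding std_normal_def lborel_prod
  proof (intro density_cong AE_I2)
    show "(\<lambda>(x, y). ennreal (exp (- (norm x)\<^sup>2 / 2) / sqrt (2 * pi) ^ DIM('a)) *
      ennreal (exp (- (norm y)\<^sup>2 / 2) / sqrt (2 * pi) ^ DIM('b))) \<in> borel_measurable (lborel :: ('a \<times> 'b) measure)"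
      by (simp add: borel_prod[symmetric])
  qed (auto simp: ennreal_mult[symmetric] norm_Pair power_add exp_add[symmetric] field_simps)
  finally show ?thesis .
qed

section \<open>Reflections and the Gram criterion for equality of Gaussian laws\<close>

lemma Householder:
  fixes a b :: "'a::euclidean_space"
  assumes "norm a = norm b"
  obtains T where "orthogonal_transformation T" "T a = b" "\<And>x. (a - b) \<bullet> x = 0 \<Longrightarrow> T x = x"
proof (cases "a = b")
  case True
  then show ?thesis using that[of "\<lambda>x. x"] by simp
next
  case False
  define u where "u = a - b"
  have u: "u \<bullet> u \<noteq> 0" using False by (simp add: u_def)
  \<comment> \<open>Reflection in the hyperplane orthogonal to \<open>u\<close>. Equal norms place
    the midpoint of \<open>a\<close> and \<open>b\<close> on it, so the reflection exchanges the
    two.\<close>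
  define T where "T x = x - (2 * (u \<bullet> x) / (u \<bullet> u)) *\<^sub>R u" for x
  show ?thesis
  proof (rule that)
    have "linear T"
      by (rule linearI) (simp_all add: T_def inner_add_right distrib_left add_divide_distrib scaleR_add_left scaleR_diff_right)
    moreover have "T v \<bullet> T w = v \<bullet> w" for v w
    proof -
      have "T v \<bullet> T w = v \<bullet> w - 2 * (2 * (u \<bullet> v) / (u \<bullet> u)) * (u \<bullet> w) +
          (2 * (u \<bullet> v) / (u \<bullet> u)) * (2 * (u \<bullet> w) / (u \<bullet> u)) * (u \<bullet> u)"
        by (simp add: T_def inner_simps inner_commute)
      then show ?thesis using u by (simp add: field_simps)
    qed
    ultimately show "orthogonal_transformation T" by (simp add: orthogonal_transformation_def)
    have "a \<bullet> a = b \<bullet> b" using assms by (metis power2_norm_eq_inner)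
    then have "2 * (u \<bullet> a) = u \<bullet> u" by (simp add: u_def inner_simps inner_commute)
    with u show "T a = b" by (simp add: T_def) (simp add: u_def)
    show "T x = x" if "(a - b) \<bullet> x = 0" for x using that by (simp add: T_def u_def)
  qed
qed

text \<open>Once the vectors indexed by \<open>I\<close> are matched, the Householder reflection that handles the next
  one fixes them all, because its direction is orthogonal to them.\<close>

lemma orthogonal_transformation_of_equal_Gram:
  fixes a b :: "'i \<Rightarrow> 'a::euclidean_space"
  assumes "finite I" "\<And>i j. i \<in> I \<Longrightarrow> j \<in> I \<Longrightarrow> a i \<bullet> a j = b i \<bullet> b j"
  shows "\<exists>T. orthogonal_transformation T \<and> (\<forall>i\<in>I. T (a i) = b i)"
  using assms
proof (induction I rule: finite_induct)
  case empty
  then show ?case using orthogonal_transformation_id by blast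
next
  case (insert k I)
  then obtain T where T: "orthogonal_transformation T" "\<And>i. i \<in> I \<Longrightarrow> T (a i) = b i"
    by (metis insertCI)
  have TT: "T v \<bullet> T w = v \<bullet> w" for v w using T(1) by (simp add: orthogonal_transformation_def)
  have "norm (T (a k)) = norm (b k)"
    using insert.prems[of k k] by (simp add: norm_eq_sqrt_inner TT)
  then obtain R where R: "orthogonal_transformation R" "R (T (a k)) = b k"
      "\<And>x. (T (a k) - b k) \<bullet> x = 0 \<Longrightarrow> R x = x"
    by (rule Householder) auto
  have "R (T (a i)) = b i" if "i \<in> I" for i
  proof -
    have "T (a k) \<bullet> T (a i) = b k \<bullet> b i"
      using insert.prems[of k i] that by (simp add: TT)
    then have "(T (a k) - b k) \<bullet> b i = 0"
      using T(2)[OF that] by (simp add: inner_diff_left)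
    then show ?thesis using R(3) T(2)[OF that] by simp
  qed
  with R(2) orthogonal_transformation_compose[OF R(1) T(1)] show ?case
    by (intro exI[of _ "R \<circ> T"]) (auto simp: comp_def)
qed

text \<open>An orthogonal \<open>T\<close> taking each \<open>a i\<close> to \<open>b i\<close>
  turns the inner product of \<open>a i\<close> with \<open>z\<close> into that of
  \<open>b i\<close> with \<open>T z\<close>, and it preserves the standard Gaussian. Hence a linear
  image of that Gaussian is determined by its covariance.\<close>

lemma distr_std_normal_eq_of_equal_Gram:
  fixes a b :: "'n::finite \<Rightarrow> 'a::euclidean_space"
  assumes "\<And>i j. a i \<bullet> a j = b i \<bullet> b j"
  shows "distr std_normal borel (\<lambda>z. \<chi> i. a i \<bullet> z) = distr std_normal borel (\<lambda>z. \<chi> i. b i \<bullet> z)"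
proof -
  obtain T where T: "orthogonal_transformation T" "\<And>i. T (a i) = b i"
    using orthogonal_transformation_of_equal_Gram[of UNIV a b] assms by auto
  have [measurable]: "(\<lambda>z. \<chi> i. b i \<bullet> z) \<in> borel_measurable borel" for b :: "'n \<Rightarrow> 'a"
    by (intro borel_measurable_continuous_onI continuous_intros)
  have [measurable]: "T \<in> borel_measurable borel"
    using T(1) by (intro borel_measurable_continuous_onI linear_continuous_on linear_conv_bounded_linear[THEN iffD1])
      (rule orthogonal_transformation_linear)
  have "a i \<bullet> z = b i \<bullet> T z" for i z
    using T by (metis orthogonal_transformation_def)
  then have "distr std_normal borel (\<lambda>z. \<chi> i. a i \<bullet> z) = distr (distr std_normal borel T) borel (\<lambda>z. \<chi> i. b i \<bullet> z)"
    by (simp add: distr_distr comp_def)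
  then show ?thesis by (simp add: distr_std_normal_orthogonal[OF T(1)])
qed

lemma std_normal_second_moment:
  assumes "b \<in> Basis"
  shows "(\<integral>\<^sup>+z. ennreal ((z \<bullet> b)\<^sup>2) \<partial>(std_normal :: 'a::euclidean_space measure)) = 1"
proof -
  have m2: "(\<integral>\<^sup>+x. ennreal (std_normal_density x * x\<^sup>2) \<partial>lborel) = 1"
    using std_normal_moment_even[of 1]
    by (subst nn_integral_eq_integral) (auto simp: has_bochner_integral_iff)
  \<comment> \<open>The squared coordinate is written as a product over all basis vectors with all
    factors but one equal to 1, so that the integral factorises.\<close>
  let ?f = "\<lambda>c x::real. if c = b then x\<^sup>2 else 1"
  have "(\<Prod>c\<in>Basis. ?f c (z \<bullet> c)) = (z \<bullet> b)\<^sup>2" for z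
    using assms by (simp add: prod.delta)
  then have "(\<integral>\<^sup>+z. ennreal ((z \<bullet> b)\<^sup>2) \<partial>(std_normal :: 'a measure)) =
    (\<integral>\<^sup>+z. ennreal (\<Prod>c\<in>Basis. ?f c (z \<bullet> c)) \<partial>std_normal)" by simp
  also have "\<dots> = (\<Prod>c\<in>Basis. \<integral>\<^sup>+x. ennreal (std_normal_density x * ?f c x) \<partial>lborel)"
    by (rule nn_integral_std_normal_prod) auto
  also have "\<dots> = 1"
    proof (intro prod.neutral ballI)
    fix c :: 'a
    show "(\<integral>\<^sup>+x. ennreal (std_normal_density x * ?f c x) \<partial>lborel) = 1"
      by (cases "c = b") (simp_all add: m2 nn_integral_std_normal_density)
  qed
  finally show ?thesis .
qed

section \<open>Positive semi-definite matrices and Gaussian laws\<close>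

lemma symmetric_dot_commute:
  fixes K :: "real^'n^'n"
  assumes "transpose K = K"
  shows "x \<bullet> (K *v y) = y \<bullet> (K *v x)"
  using assms by (metis dot_lmul_matrix inner_commute transpose_matrix_vector)

text \<open>Symmetric Gaussian elimination: subtracting the square of a pivot row keeps the matrix
  positive semi-definite and clears that row.\<close>

lemma psd_sum_of_squares:
  fixes K :: "real^'n^'n"
  assumes "finite I" "psd K" "\<And>i j. i \<notin> I \<Longrightarrow> K $ i $ j = 0"
  shows "\<exists>a :: 'n \<Rightarrow> real^'n. \<forall>p q. K $ p $ q = (\<Sum>i\<in>I. a i $ p * a i $ q)"
  using assms
proof (induction I arbitrary: K rule: finite_induct)
  case empty
  then show ?case by auto
next
  case (insert k I)
  define c where "c = K $ k $ k"
  have sym: "transpose K = K" and pos: "0 \<le> x \<bullet> (K *v x)" for x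
    using insert.prems(1) by (auto simp: psd_def)
  have sym': "K $ i $ j = K $ j $ i" for i j
    using sym by (metis transpose_def vec_lambda_beta)
  have Kk: "(K *v axis k 1) = K $ k"
    by (simp add: vec_eq_iff matrix_vector_mult_basis column_def sym'[of k])
  have "0 \<le> c"
    using pos[of "axis k 1"] by (simp add: Kk c_def inner_axis')
  show ?case
  proof (cases "c = 0")
    case True
    have "K $ k $ j = 0" for j
    proof (rule ccontr)
      assume ne: "K $ k $ j \<noteq> 0"
      \<comment> \<open>With a vanishing pivot the quadratic form at \<open>?x\<close> is affine in
        \<open>t\<close> with slope \<open>2 * K $ k $ j\<close>; this \<open>t\<close> brings it to
        \<open>- 1\<close>.\<close>
      define t where "t = - (K $ j $ j + 1) / (2 * K $ k $ j)"
      define e where "e = (axis j 1 :: real^'n)"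
      let ?x = "t *\<^sub>R axis k 1 + e"
      have "?x \<bullet> (K *v ?x) = t * t * c + t * (axis k 1 \<bullet> (K *v e)) + t * (e \<bullet> (K *v axis k 1)) + e \<bullet> (K *v e)"
        by (simp add: matrix_vector_right_distrib matrix_vector_mult_scaleR inner_simps Kk c_def inner_axis' algebra_simps)
      also have "\<dots> = 2 * t * K $ k $ j + K $ j $ j"
        using True by (simp add: symmetric_dot_commute[OF sym, of "axis k 1" e] Kk)
          (simp add: e_def inner_axis' matrix_vector_mult_basis column_def)
      also have "\<dots> = - 1" using ne by (simp add: t_def field_simps)
      finally show False using pos[of ?x] by simp
    qed
    then have "K $ i $ j = 0" if "i \<notin> I" for i j
      using insert.prems(2)[of i j] that by (cases "i = k") auto
    with insert.IH[OF insert.prems(1)] obtain a :: "'n \<Rightarrow> real^'n"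
      where a: "\<And>p q. K $ p $ q = (\<Sum>i\<in>I. a i $ p * a i $ q)" by blast
    have "(\<Sum>i\<in>insert k I. (a(k := 0)) i $ p * (a(k := 0)) i $ q) = (\<Sum>i\<in>I. a i $ p * a i $ q)" for p q
      using insert.hyps by (auto intro!: sum.cong)
    then show ?thesis using a by metis
  next
    case False
    with \<open>0 \<le> c\<close> have c: "0 < c" by simp
    \<comment> \<open>The Schur complement of the pivot, padded with a zero row and column.\<close>
    define K' where "K' = (\<chi> p q. K $ p $ q - K $ k $ p * K $ k $ q / c)"
    have K'v: "K' *v x = K *v x - ((K $ k \<bullet> x) / c) *\<^sub>R (K $ k)" for x
    proof -
      have "(K' *v x) $ i = (\<Sum>j\<in>UNIV. K $ i $ j * x $ j - (K $ k $ i / c) * (K $ k $ j * x $ j))" for i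
        by (simp add: K'_def matrix_vector_mult_def left_diff_distrib mult.assoc)
      then show ?thesis
        unfolding sum_subtractf sum_distrib_left[symmetric]
        by (simp add: vec_eq_iff matrix_vector_mult_def inner_vec_def)
    qed
    have "psd K'"
      unfolding psd_def
    proof (intro conjI allI)
      show "transpose K' = K'"
        by (simp add: K'_def transpose_def vec_eq_iff sym' mult.commute)
      fix x
      define s where "s = (K $ k \<bullet> x) / c"
      \<comment> \<open>\<open>?y\<close> minimises the form of \<open>K\<close> along the line
        through \<open>x\<close> in direction \<open>k\<close>; the minimum is the form of
        \<open>K'\<close> at \<open>x\<close>, which is therefore nonnegative.\<close>
      let ?y = "x - s *\<^sub>R axis k 1"
      have sc: "K $ k \<bullet> x = s * c" using c by (simp add: s_def)
      have "?y \<bullet> (K *v ?y) = x \<bullet> (K *v x) - s * (axis k 1 \<bullet> (K *v x)) - s * (x \<bullet> (K *v axis k 1)) + s * s * c"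
        by (simp add: matrix_vector_mult_diff_distrib matrix_vector_mult_scaleR inner_simps Kk c_def inner_axis' algebra_simps)
      also have "\<dots> = x \<bullet> (K *v x) - s * (s * c)"
        by (simp add: symmetric_dot_commute[OF sym, of "axis k 1" x] Kk inner_commute[of x] sc)
      also have "\<dots> = x \<bullet> (K' *v x)"
        using c by (simp add: K'v inner_simps inner_commute[of x] sc)
      finally show "0 \<le> x \<bullet> (K' *v x)" using pos[of ?y] by simp
    qed
    moreover have "K' $ i $ j = 0" if "i \<notin> I" for i j
      using insert.prems(2)[of i j] insert.prems(2)[of i k] that c sym'[of k i]
      by (cases "i = k") (auto simp: K'_def c_def)
    ultimately obtain a :: "'n \<Rightarrow> real^'n" where a: "\<And>p q. K' $ p $ q = (\<Sum>i\<in>I. a i $ p * a i $ q)"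
      using insert.IH by blast
    define b where "b = a(k := (1 / sqrt c) *\<^sub>R K $ k)"
    have "K $ p $ q = (\<Sum>i\<in>insert k I. b i $ p * b i $ q)" for p q
    proof -
      have "(\<Sum>i\<in>insert k I. b i $ p * b i $ q) = b k $ p * b k $ q + (\<Sum>i\<in>I. a i $ p * a i $ q)"
        using insert.hyps by (auto simp: b_def intro!: sum.cong)
      also have "b k $ p * b k $ q = K $ k $ p * K $ k $ q / c"
        using c by (simp add: b_def real_sqrt_mult_self)
      finally show ?thesis by (simp add: a[symmetric] K'_def)
    qed
    then show ?thesis by blast
  qed
qed

lemma psd_factorization:
  fixes K :: "real^'n^'n"
  assumes "psd K"
  obtains A :: "real^'n^'n" where "A ** transpose A = K"
proof -
  obtain a :: "'n \<Rightarrow> real^'n" where a: "\<And>p q. K $ p $ q = (\<Sum>i\<in>UNIV. a i $ p * a i $ q)"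
    using psd_sum_of_squares[of UNIV K] assms by auto
  show ?thesis
    by (rule that[of "\<chi> p i. a i $ p"]) (simp add: vec_eq_iff matrix_matrix_mult_def transpose_def a)
qed

lemma pos_def_imp_psd: "pos_def K \<Longrightarrow> psd K"
  unfolding pos_def_def psd_def by (metis inner_zero_left less_eq_real_def)

lemma psd_add: "psd K \<Longrightarrow> psd L \<Longrightarrow> psd (K + L)"
  by (auto simp: psd_def transpose_def vec_eq_iff matrix_vector_mult_add_rdistrib inner_add_right)

lemma psd_add_pos_def: "psd K \<Longrightarrow> pos_def L \<Longrightarrow> pos_def (K + L)"
  by (auto simp: psd_def pos_def_def transpose_def vec_eq_iff matrix_vector_mult_add_rdistrib inner_add_right
    intro!: add_nonneg_pos)

section \<open>Gaussian laws as linear images of the standard Gaussian\<close>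

lemma matrix_vector_mult_measurable [measurable]: "(*v) (A :: real^'n^'m) \<in> borel_measurable borel"
  by (intro borel_measurable_continuous_onI linear_continuous_on matrix_vector_mul_bounded_linear)

lemma matrix_vector_mult_rows: "(*v) A = (\<lambda>z. \<chi> i. row i A \<bullet> z)"
  by (simp add: fun_eq_iff vec_eq_iff matrix_vector_mult_def inner_vec_def row_def)

lemma inner_rows: "row i A \<bullet> row j B = (A ** transpose B) $ i $ j"
  by (simp add: inner_vec_def row_def matrix_matrix_mult_def transpose_def)

text \<open>This removes the choice operator from \<open>gaussian\<close>: the rows of any two
  factors of \<open>K\<close> have the same Gram matrix \<open>K\<close>, so both factors give the
  same law.\<close>

lemma gaussian_eq:
  fixes A :: "real^'n^'n"
  assumes "A ** transpose A = K"
  shows "gaussian K = distr std_normal borel ((*v) A)"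
proof -
  let ?B = "SOME A :: real^'n^'n. A ** transpose A = K"
  have "?B ** transpose ?B = K" using assms by (rule someI)
  then have "distr std_normal borel ((*v) ?B) = distr std_normal borel ((*v) A)"
    unfolding matrix_vector_mult_rows
    by (intro distr_std_normal_eq_of_equal_Gram) (simp add: inner_rows assms)
  then show ?thesis by (simp add: gaussian_def std_gaussian_eq_std_normal)
qed

lemma sets_gaussian [simp, measurable_cong]: "sets (gaussian K) = sets borel"
  by (simp add: gaussian_def)

lemma space_gaussian [simp]: "space (gaussian K) = UNIV"
  by (simp add: gaussian_def)

lemma prob_space_gaussian: "prob_space (gaussian K)"
  unfolding gaussian_def std_gaussian_eq_std_normal
  by (intro prob_space.prob_space_distr prob_space_std_normal) measurable

text \<open>Both sides are linear images of the standard Gaussian on the product space, under maps with rows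
  \<open>(A\<^sub>i, A'\<^sub>i)\<close> and \<open>(B\<^sub>i, 0)\<close>, which have the same Gram matrix.\<close>

lemma gaussian_convolution:
  fixes K L :: "real^'n^'n"
  assumes "psd K" "psd L"
  shows "distr (gaussian K \<Otimes>\<^sub>M gaussian L) borel (\<lambda>(x, y). x + y) = gaussian (K + L)"
proof -
  obtain A A' B :: "real^'n^'n" where
    A: "A ** transpose A = K" and A': "A' ** transpose A' = L" and B: "B ** transpose B = K + L"
    using assms by (metis psd_factorization psd_add)
  interpret prob_space "std_normal :: (real^'n) measure" by (rule prob_space_std_normal)
  interpret P: pair_prob_space "std_normal :: (real^'n) measure" "std_normal :: (real^'n) measure" ..
  have sf: "sigma_finite_measure (distr std_normal borel ((*v) A'))"
    by (intro prob_space_imp_sigma_finite prob_space_distr) measurable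
  have [measurable]: "(\<lambda>z. \<chi> i. (b i, c i) \<bullet> z) \<in> borel_measurable borel" for b c :: "'n \<Rightarrow> real^'n"
    by (intro borel_measurable_continuous_onI continuous_intros)
  have "distr (gaussian K \<Otimes>\<^sub>M gaussian L) borel (\<lambda>(x, y). x + y) =
      distr (std_normal \<Otimes>\<^sub>M std_normal) borel (\<lambda>(x, y). A *v x + A' *v y)"
    unfolding gaussian_eq[OF A] gaussian_eq[OF A']
    by (subst pair_measure_distr) (auto simp: sf distr_distr comp_def split_beta')
  also have "\<dots> = distr std_normal borel (\<lambda>z. \<chi> i. (row i A, row i A') \<bullet> z)"
    unfolding std_normal_pair[symmetric]
    by (intro distr_cong) (auto simp: matrix_vector_mult_rows vec_eq_iff)
  also have "\<dots> = distr std_normal borel (\<lambda>z. \<chi> i. (row i B, 0 :: real^'n) \<bullet> z)"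
    by (rule distr_std_normal_eq_of_equal_Gram) (simp add: inner_rows A A' B)
  also have "\<dots> = distr ((std_normal :: (real^'n) measure) \<Otimes>\<^sub>M (std_normal :: (real^'n) measure)) borel ((*v) B \<circ> fst)"
    unfolding std_normal_pair[symmetric]
    by (intro distr_cong) (auto simp: matrix_vector_mult_rows vec_eq_iff)
  also have "\<dots> = distr (distr ((std_normal :: (real^'n) measure) \<Otimes>\<^sub>M (std_normal :: (real^'n) measure)) std_normal fst) borel ((*v) B)"
    by (subst distr_distr) auto
  also have "\<dots> = gaussian (K + L)"
    by (simp add: distr_pair_fst gaussian_eq[OF B])
  finally show ?thesis .
qed

section \<open>Densities of nondegenerate Gaussians\<close>

definition gauss_dens :: "real^'n^'n \<Rightarrow> real^'n \<Rightarrow> real" where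
  "gauss_dens K y = exp (- (y \<bullet> (matrix_inv K *v y)) / 2) / (sqrt (2 * pi) ^ CARD('n) * sqrt (det K))"

lemma pos_def_invertible:
  fixes K :: "real^'n^'n"
  assumes "pos_def K" shows "invertible K"
proof -
  have "x = 0" if "K *v x = 0" for x
    using assms that by (metis inner_zero_right less_irrefl pos_def_def)
  then show ?thesis
    by (simp add: invertible_left_inverse matrix_left_invertible_ker)
qed

lemma matrix_inv_cancel:
  fixes A :: "real^'n^'n"
  assumes "invertible A"
  shows "A ** matrix_inv A = mat 1" "matrix_inv A ** A = mat 1"
  using assms someI_ex[of "\<lambda>B. A ** B = mat 1 \<and> B ** A = mat 1"]
  by (auto simp: invertible_def matrix_inv_def)

text \<open>Collects what the substitution \<open>y = A *v z\<close> needs to carry the standard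
  normal density to covariance \<open>K\<close>: the quadratic form becomes a squared norm, and the
  absolute value of \<open>det A\<close> is the square root of \<open>det K\<close>.\<close>

lemma pos_def_factorization:
  fixes K :: "real^'n^'n"
  assumes "pos_def K"
  obtains A :: "real^'n^'n" where "A ** transpose A = K" "det A \<noteq> 0" "det K = (det A)\<^sup>2"
    "\<And>y. y \<bullet> (matrix_inv K *v y) = (norm (matrix_inv A *v y))\<^sup>2"
    "\<And>x. matrix_inv A *v (A *v x) = x"
proof -
  obtain A :: "real^'n^'n" where A: "A ** transpose A = K"
    using assms psd_factorization pos_def_imp_psd by metis
  have detK: "det K = (det A)\<^sup>2"
    by (simp add: A[symmetric] det_mul power2_eq_square)
  have inv: "invertible K" by (rule pos_def_invertible) fact
  then have d: "det A \<noteq> 0" by (auto simp: invertible_det_nz detK)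
  then have AA: "A ** matrix_inv A = mat 1" "matrix_inv A ** A = mat 1"
    by (auto simp: invertible_det_nz matrix_inv_cancel)
  let ?L = "transpose (matrix_inv A) ** matrix_inv A"
  have TA: "transpose A ** transpose (matrix_inv A) = mat 1"
    by (simp add: matrix_transpose_mul[symmetric] AA)
  have "K ** ?L = A ** (transpose A ** transpose (matrix_inv A)) ** matrix_inv A"
    by (simp add: A[symmetric] matrix_mul_assoc)
  then have KL: "K ** ?L = mat 1" by (simp add: TA AA)
  have "matrix_inv K = matrix_inv K ** (K ** ?L)" by (simp add: KL)
  also have "\<dots> = ?L" by (simp add: matrix_mul_assoc matrix_inv_cancel[OF inv])
  finally have L: "matrix_inv K = ?L" .
  show ?thesis
  proof (rule that[OF A d detK])
    show "y \<bullet> (matrix_inv K *v y) = (norm (matrix_inv A *v y))\<^sup>2" for y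
      unfolding L power2_norm_eq_inner matrix_vector_mul_assoc[symmetric]
      by (metis dot_lmul_matrix transpose_matrix_vector transpose_transpose)
    show "matrix_inv A *v (A *v x) = x" for x
      by (simp add: matrix_vector_mul_assoc AA)
  qed
qed

lemma det_pos_def: "pos_def K \<Longrightarrow> 0 < det K"
  by (elim pos_def_factorization) simp

lemma gauss_dens_measurable [measurable]: "gauss_dens K \<in> borel_measurable borel"
  unfolding gauss_dens_def by measurable

text \<open>Substituting \<open>y = A *v z\<close> in the standard normal density, the Jacobian
  accounts for the factor \<open>sqrt (det K)\<close> in the normalisation.\<close>

lemma gaussian_density:
  fixes K :: "real^'n^'n"
  assumes "pos_def K"
  shows "gaussian K = density lborel (\<lambda>y. ennreal (gauss_dens K y))"
proof (rule measure_eqI)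
  obtain A :: "real^'n^'n" where A: "A ** transpose A = K" "det A \<noteq> 0" "det K = (det A)\<^sup>2"
    "\<And>y. y \<bullet> (matrix_inv K *v y) = (norm (matrix_inv A *v y))\<^sup>2"
    "\<And>x. matrix_inv A *v (A *v x) = x"
    using pos_def_factorization[OF assms] by blast
  fix S assume "S \<in> sets (gaussian K)"
  then have [measurable]: "S \<in> sets borel" by simp
  have "emeasure (gaussian K) S = emeasure std_normal ((*v) A -` S)"
    using measurable_sets_borel[of "(*v) A" borel S]
    by (simp add: gaussian_eq[OF A(1)] emeasure_distr)
  also have "\<dots> = (\<integral>\<^sup>+z. ennreal (exp (- (norm z)\<^sup>2 / 2) / sqrt (2 * pi) ^ CARD('n)) * indicator S (A *v z) \<partial>lborel)"
    using measurable_sets_borel[of "(*v) A" borel S]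
    by (simp add: std_normal_def emeasure_density indicator_def vimage_def)
  also have "\<dots> = (\<integral>\<^sup>+z. ennreal \<bar>det A\<bar> * (ennreal (gauss_dens K (A *v z)) * indicator S (A *v z)) \<partial>lborel)"
    using A(2) by (intro nn_integral_cong)
      (simp add: gauss_dens_def A(3,4,5) ennreal_mult[symmetric] mult.assoc[symmetric])
  also have "\<dots> = (\<integral>\<^sup>+y. ennreal (gauss_dens K y) * indicator S y \<partial>lborel)"
    by (subst nn_integral_lborel_matrix[OF A(2)]) (auto simp: nn_integral_cmult)
  finally show "emeasure (gaussian K) S = emeasure (density lborel (\<lambda>y. ennreal (gauss_dens K y))) S"
    by (simp add: emeasure_density)
qed simp

section \<open>Second moments\<close>

lemma std_normal_mixed_moment:
  assumes "b \<in> Basis" "c \<in> Basis"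
  shows "integrable (std_normal :: 'a::euclidean_space measure) (\<lambda>z. (z \<bullet> b) * (z \<bullet> c))"
    and "(\<integral>z. (z \<bullet> b) * (z \<bullet> c) \<partial>(std_normal :: 'a measure)) = (if b = c then 1 else 0)"
proof -
  have sq: "integrable (std_normal :: 'a measure) (\<lambda>z. (z \<bullet> b)\<^sup>2)" if "b \<in> Basis" for b
    using std_normal_second_moment[OF that] by (intro integrableI_nonneg) auto
  have "integrable (std_normal :: 'a measure) (\<lambda>z. (z \<bullet> b)\<^sup>2 + (z \<bullet> c)\<^sup>2)"
    using assms by (intro Bochner_Integration.integrable_add sq)
  then show "integrable (std_normal :: 'a measure) (\<lambda>z. (z \<bullet> b) * (z \<bullet> c))"
  proof (rule Bochner_Integration.integrable_bound)
    show "AE z in std_normal. norm ((z \<bullet> b) * (z \<bullet> c)) \<le> norm ((z \<bullet> b)\<^sup>2 + (z \<bullet> c)\<^sup>2)"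
    proof (rule AE_I2)
      fix z
      have "2 * \<bar>z \<bullet> b\<bar> * \<bar>z \<bullet> c\<bar> \<le> \<bar>z \<bullet> b\<bar>\<^sup>2 + \<bar>z \<bullet> c\<bar>\<^sup>2" by (rule sum_squares_bound)
      moreover have "0 \<le> \<bar>z \<bullet> b\<bar> * \<bar>z \<bullet> c\<bar>" by simp
      ultimately have "\<bar>z \<bullet> b\<bar> * \<bar>z \<bullet> c\<bar> \<le> \<bar>z \<bullet> b\<bar>\<^sup>2 + \<bar>z \<bullet> c\<bar>\<^sup>2" by linarith
      then show "norm ((z \<bullet> b) * (z \<bullet> c)) \<le> norm ((z \<bullet> b)\<^sup>2 + (z \<bullet> c)\<^sup>2)"
        by (simp add: abs_mult)
    qed
  qed measurable
  show "(\<integral>z. (z \<bullet> b) * (z \<bullet> c) \<partial>(std_normal :: 'a measure)) = (if b = c then 1 else 0)"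
  proof (cases "b = c")
    case True
    have "(\<integral>z. (z \<bullet> b)\<^sup>2 \<partial>(std_normal :: 'a measure)) = 1"
      using std_normal_second_moment[OF assms(1)] by (subst integral_eq_nn_integral) auto
    then show ?thesis using True by (simp add: power2_eq_square)
  next
    case False
    \<comment> \<open>The reflection taking \<open>b\<close> to \<open>- b\<close> fixes
      \<open>c\<close> and preserves the Gaussian, so the mixed moment equals its own
      negative.\<close>
    have "norm b = norm (- b)" by simp
    then obtain T where T: "orthogonal_transformation T" "T b = - b" "\<And>x. (b - (- b)) \<bullet> x = 0 \<Longrightarrow> T x = x"
      by (rule Householder) blast
    have [measurable]: "T \<in> borel_measurable borel"
      using T(1) by (intro borel_measurable_continuous_onI linear_continuous_on linear_conv_bounded_linear[THEN iffD1])
        (rule orthogonal_transformation_linear)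
    have "T c = c" using False assms by (intro T(3)) (simp add: inner_not_same_Basis inner_add_left)
    have TT: "T v \<bullet> T w = v \<bullet> w" for v w using T(1) by (simp add: orthogonal_transformation_def)
    have "T z \<bullet> b = - (z \<bullet> b)" "T z \<bullet> c = z \<bullet> c" for z
      using TT[of z b] TT[of z c] by (auto simp: T(2) \<open>T c = c\<close>)
    then have "(\<integral>z. (z \<bullet> b) * (z \<bullet> c) \<partial>distr (std_normal :: 'a measure) borel T) = - (\<integral>z. (z \<bullet> b) * (z \<bullet> c) \<partial>std_normal)"
      by (subst integral_distr) auto
    then show ?thesis using False by (simp add: distr_std_normal_orthogonal[OF T(1)])
  qed
qed

lemma gaussian_moments:
  fixes A :: "real^'n^'n"
  shows "integrable std_normal (\<lambda>z. (A *v z) $ p * (A *v z) $ q)"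
    and "(\<integral>z. (A *v z) $ p * (A *v z) $ q \<partial>std_normal) = (A ** transpose A) $ p $ q"
proof -
  have m: "integrable std_normal (\<lambda>z :: real^'n. z $ i * z $ j)"
    "(\<integral>z. z $ i * z $ j \<partial>(std_normal :: (real^'n) measure)) = (if i = j then 1 else 0)" for i j
    using std_normal_mixed_moment[of "axis i 1 :: real^'n" "axis j 1"]
    by (auto simp: inner_axis axis_eq_axis)
  have eq: "(A *v z) $ p * (A *v z) $ q = (\<Sum>i\<in>UNIV. \<Sum>j\<in>UNIV. A $ p $ i * A $ q $ j * (z $ i * z $ j))" for z
    by (simp add: matrix_vector_mult_def sum_product mult_ac)
  show "integrable std_normal (\<lambda>z. (A *v z) $ p * (A *v z) $ q)"
    unfolding eq by (intro Bochner_Integration.integrable_sum integrable_mult_right m)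
  show "(\<integral>z. (A *v z) $ p * (A *v z) $ q \<partial>std_normal) = (A ** transpose A) $ p $ q"
    unfolding eq by (simp add: m matrix_matrix_mult_def transpose_def if_distrib cong: if_cong)
qed

lemma integrable_norm_power2I:
  fixes f :: "'a \<Rightarrow> real^'n"
  assumes "\<And>i. integrable M (\<lambda>x. f x $ i * f x $ i)"
  shows "integrable M (\<lambda>x. (norm (f x))\<^sup>2)"
  unfolding power2_norm_eq_inner inner_vec_def inner_real_def
  by (intro Bochner_Integration.integrable_sum assms)

lemma matrix_vector_mult_minus: "A *v (- x) = - (A *v x)" for A :: "real^'n^'m"
  using matrix_vector_mult_diff_distrib[of A 0 x] by simp

lemma gaussian_in_centered_laws:
  fixes K :: "real^'n^'n"
  assumes "psd K"
  shows "gaussian K \<in> centered_laws K"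
proof -
  obtain A :: "real^'n^'n" where A: "A ** transpose A = K"
    using psd_factorization[OF assms] by blast
  have g: "gaussian K = distr std_normal borel ((*v) A)" by (rule gaussian_eq[OF A])
  \<comment> \<open>The standard Gaussian is invariant under negation, so the mean vector equals its
    own negative.\<close>
  define v where "v = (\<integral>z. A *v z \<partial>std_normal)"
  have "orthogonal_transformation (uminus :: real^'n \<Rightarrow> _)"
    by (simp add: orthogonal_transformation_neg[where f="\<lambda>x. x", simplified])
  then have "v = (\<integral>z. A *v z \<partial>distr std_normal borel uminus)"
    by (simp only: distr_std_normal_orthogonal v_def)
  also have "\<dots> = - v"
    unfolding v_def by (subst integral_distr) (auto simp: matrix_vector_mult_minus)
  finally have "2 *\<^sub>R v = 0"
    unfolding scaleR_2 by (metis add.right_inverse)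
  then have mean: "(\<integral>x. x \<partial>gaussian K) = 0"
    by (simp add: g integral_distr v_def)
  moreover have "integrable (gaussian K) (\<lambda>x. (norm x)\<^sup>2)"
    by (simp add: g integrable_distr_eq integrable_norm_power2I gaussian_moments)
  moreover have "covariance_matrix (gaussian K) = K"
    by (simp add: covariance_matrix_def mean vec_eq_iff) (simp add: g integral_distr gaussian_moments A)
  ultimately show ?thesis
    by (simp add: centered_laws_def prob_space_gaussian)
qed

lemma centered_lawsD:
  assumes "P \<in> centered_laws (K :: real^'n^'n)"
  shows "prob_space P" "sets P = sets borel"
    and "integrable P (\<lambda>x. x $ i)" "(\<integral>x. x $ i \<partial>P) = 0"
    and "integrable P (\<lambda>x. x $ i * x $ j)" "(\<integral>x. x $ i * x $ j \<partial>P) = K $ i $ j"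
proof -
  show ps: "prob_space P" and s [measurable_cong]: "sets P = sets borel"
    using assms by (auto simp: centered_laws_def)
  interpret prob_space P by fact
  have n2: "integrable P (\<lambda>x. (norm x)\<^sup>2)" and mean: "(\<integral>x. x \<partial>P) = 0" and cov: "covariance_matrix P = K"
    using assms by (auto simp: centered_laws_def)
  show 2: "integrable P (\<lambda>x. x $ i * x $ j)" for i j
  proof (rule Bochner_Integration.integrable_bound[OF n2])
    show "AE x in P. norm (x $ i * x $ j) \<le> norm ((norm x)\<^sup>2)"
      by (auto simp: abs_mult power2_eq_square intro!: AE_I2 mult_mono component_le_norm_cart)
  qed measurable
  \<comment> \<open>On a probability space \<open>1 + (norm x)\<^sup>2\<close> is integrable and
    dominates the norm, so the mean is a genuine integral and may be taken coordinatewise.\<close>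
  have 1: "integrable P (\<lambda>x. x)"
  proof (rule Bochner_Integration.integrable_bound)
    show "integrable P (\<lambda>x. 1 + (norm x)\<^sup>2)" using n2 by simp
    have "r \<le> 1 + r\<^sup>2" for r :: real
      using sum_squares_bound[of r 1] by simp (smt (verit) zero_le_power2)
    then show "AE x in P. norm x \<le> norm (1 + (norm x)\<^sup>2)" by auto
  qed measurable
  have bl: "bounded_linear (\<lambda>x :: real^'n. x $ i)" by (rule bounded_linear_vec_nth)
  show "integrable P (\<lambda>x. x $ i)" by (rule integrable_bounded_linear[OF bl 1])
  show "(\<integral>x. x $ i \<partial>P) = 0" using integral_bounded_linear[OF bl 1] by (simp add: mean)
  show "(\<integral>x. x $ i * x $ j \<partial>P) = K $ i $ j"
    unfolding cov[symmetric] by (simp add: covariance_matrix_def mean)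
qed

text \<open>A quadratic form is a linear combination of second moments. This is why the expected
  logarithm of a Gaussian density sees a centered law only through its covariance.\<close>

lemma centered_laws_quadratic_form:
  assumes "P \<in> centered_laws (K :: real^'n^'n)"
  shows "integrable P (\<lambda>x. x \<bullet> (M *v x))" "(\<integral>x. x \<bullet> (M *v x) \<partial>P) = trace (M ** K)"
proof -
  have eq: "x \<bullet> (M *v x) = (\<Sum>i\<in>UNIV. \<Sum>j\<in>UNIV. M $ i $ j * (x $ j * x $ i))" for x
    by (simp add: inner_vec_def matrix_vector_mult_def sum_distrib_left mult_ac)
  note D = centered_lawsD(5,6)[OF assms]
  show "integrable P (\<lambda>x. x \<bullet> (M *v x))"
    unfolding eq by (intro Bochner_Integration.integrable_sum integrable_mult_right D)
  show "(\<integral>x. x \<bullet> (M *v x) \<partial>P) = trace (M ** K)"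
    unfolding eq by (simp add: D trace_def matrix_matrix_mult_def)
qed

lemma borel_measurable_vec_nth_comp [measurable (raw)]:
  fixes f :: "'a \<Rightarrow> real^'n"
  shows "f \<in> borel_measurable M \<Longrightarrow> (\<lambda>x. f x $ i) \<in> borel_measurable M"
  by (rule measurable_compose[where g="\<lambda>y. y $ i"])
    (auto intro!: borel_measurable_continuous_onI continuous_intros)

section \<open>Marginals and sums of independent vectors\<close>

context pair_prob_space
begin

lemma distr_pair_snd: "distr (M1 \<Otimes>\<^sub>M M2) M2 snd = M2"
proof -
  have "distr (M1 \<Otimes>\<^sub>M M2) M2 snd = distr (distr (M2 \<Otimes>\<^sub>M M1) (M1 \<Otimes>\<^sub>M M2) (\<lambda>(x, y). (y, x))) M2 snd"
    by (subst distr_pair_swap) simp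
  also have "\<dots> = distr (M2 \<Otimes>\<^sub>M M1) M2 fst"
    by (subst distr_distr) (auto simp: comp_def split_beta')
  finally show ?thesis by (simp add: M1.distr_pair_fst)
qed

lemma integral_comp_fst:
  fixes f :: "'a \<Rightarrow> real"
  assumes f: "integrable M1 f"
  shows "integrable (M1 \<Otimes>\<^sub>M M2) (\<lambda>z. f (fst z))" "(\<integral>z. f (fst z) \<partial>(M1 \<Otimes>\<^sub>M M2)) = (\<integral>x. f x \<partial>M1)"
proof -
  have [measurable]: "f \<in> borel_measurable M1" using f by auto
  have "integrable (distr (M1 \<Otimes>\<^sub>M M2) M1 fst) f" by (simp add: M2.distr_pair_fst f)
  then show "integrable (M1 \<Otimes>\<^sub>M M2) (\<lambda>z. f (fst z))" by (subst (asm) integrable_distr_eq) auto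
  have "(\<integral>x. f x \<partial>distr (M1 \<Otimes>\<^sub>M M2) M1 fst) = (\<integral>z. f (fst z) \<partial>(M1 \<Otimes>\<^sub>M M2))"
    by (rule integral_distr) measurable
  then show "(\<integral>z. f (fst z) \<partial>(M1 \<Otimes>\<^sub>M M2)) = (\<integral>x. f x \<partial>M1)" by (simp add: M2.distr_pair_fst)
qed

lemma integral_comp_snd:
  fixes f :: "'b \<Rightarrow> real"
  assumes f: "integrable M2 f"
  shows "integrable (M1 \<Otimes>\<^sub>M M2) (\<lambda>z. f (snd z))" "(\<integral>z. f (snd z) \<partial>(M1 \<Otimes>\<^sub>M M2)) = (\<integral>x. f x \<partial>M2)"
proof -
  have [measurable]: "f \<in> borel_measurable M2" using f by auto
  have "integrable (distr (M1 \<Otimes>\<^sub>M M2) M2 snd) f" by (simp add: distr_pair_snd f)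
  then show "integrable (M1 \<Otimes>\<^sub>M M2) (\<lambda>z. f (snd z))" by (subst (asm) integrable_distr_eq) auto
  have "(\<integral>x. f x \<partial>distr (M1 \<Otimes>\<^sub>M M2) M2 snd) = (\<integral>z. f (snd z) \<partial>(M1 \<Otimes>\<^sub>M M2))"
    by (rule integral_distr) measurable
  then show "(\<integral>z. f (snd z) \<partial>(M1 \<Otimes>\<^sub>M M2)) = (\<integral>x. f x \<partial>M2)" by (simp add: distr_pair_snd)
qed

end

text \<open>The second moments of the sum are those of the summands plus cross terms, and the cross
  terms vanish by independence and zero means.\<close>

lemma centered_laws_convolution:
  fixes K L :: "real^'n^'n"
  assumes P: "P \<in> centered_laws K" and Q: "Q \<in> centered_laws L"
  shows "distr (P \<Otimes>\<^sub>M Q) borel (\<lambda>(x, y). x + y) \<in> centered_laws (K + L)"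
proof -
  note [measurable_cong] = centered_lawsD(2)[OF P] centered_lawsD(2)[OF Q]
  interpret P: prob_space P using P by (rule centered_lawsD)
  interpret Q: prob_space Q using Q by (rule centered_lawsD)
  interpret PQ: pair_prob_space P Q ..
  let ?R = "distr (P \<Otimes>\<^sub>M Q) borel (\<lambda>(x, y). x + y)"
  note DP = centered_lawsD(3-)[OF P] and DQ = centered_lawsD(3-)[OF Q]
  note f = PQ.integral_comp_fst and s = PQ.integral_comp_snd
  have cross: "integrable (P \<Otimes>\<^sub>M Q) (\<lambda>z. fst z $ i * snd z $ j)"
    "(\<integral>z. fst z $ i * snd z $ j \<partial>(P \<Otimes>\<^sub>M Q)) = 0" for i j
  proof -
    show I: "integrable (P \<Otimes>\<^sub>M Q) (\<lambda>z. fst z $ i * snd z $ j)"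
    proof (rule Bochner_Integration.integrable_bound)
      show "integrable (P \<Otimes>\<^sub>M Q) (\<lambda>z. fst z $ i * fst z $ i + snd z $ j * snd z $ j)"
        by (intro Bochner_Integration.integrable_add f[OF DP(3)] s[OF DQ(3)])
      have "\<bar>x * y\<bar> \<le> x * x + y * y" for x y :: real
        using sum_squares_bound[of "\<bar>x\<bar>" "\<bar>y\<bar>"] abs_ge_zero[of "x * y"]
        unfolding abs_mult power2_eq_square abs_mult_self_eq by linarith
      then show "AE z in P \<Otimes>\<^sub>M Q. norm (fst z $ i * snd z $ j) \<le> norm (fst z $ i * fst z $ i + snd z $ j * snd z $ j)"
        by (intro AE_I2) (auto intro: order_trans[OF _ abs_ge_self])
    qed measurable
    have "(\<integral>z. fst z $ i * snd z $ j \<partial>(P \<Otimes>\<^sub>M Q)) = (\<integral>x. \<integral>y. x $ i * y $ j \<partial>Q \<partial>P)"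
      using PQ.integral_fst'[OF I] by simp
    also have "\<dots> = 0" by (simp add: DQ)
    finally show "(\<integral>z. fst z $ i * snd z $ j \<partial>(P \<Otimes>\<^sub>M Q)) = 0" .
  qed
  have expand: "(x $ i + y $ i) * (x $ j + y $ j) = (x $ i * x $ j + y $ i * y $ j) + (x $ i * y $ j + x $ j * y $ i)"
    for x y :: "real^'n" and i j by (simp add: algebra_simps)
  have m2: "integrable ?R (\<lambda>x. x $ i * x $ j)" "(\<integral>x. x $ i * x $ j \<partial>?R) = K $ i $ j + L $ i $ j" for i j
    using f[OF DP(3)[of i j]] s[OF DQ(3)[of i j]] cross[of i j] cross[of j i]
    by (auto simp: integrable_distr_eq integral_distr split_beta' expand DP DQ)
  have mi: "integrable ?R (\<lambda>x. x $ i)" "(\<integral>x. x $ i \<partial>?R) = 0" for i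
    using f[OF DP(1)[of i]] s[OF DQ(1)[of i]]
    by (auto simp: integrable_distr_eq integral_distr split_beta' DP DQ)
  \<comment> \<open>Integrability of the vector-valued identity is assembled from its coordinates,
    so that the mean can be computed coordinatewise.\<close>
  have "integrable ?R (\<lambda>x. \<Sum>i\<in>UNIV. x $ i *\<^sub>R axis i (1::real))"
    by (intro Bochner_Integration.integrable_sum integrable_scaleR_left mi)
  moreover have "(\<lambda>x :: real^'n. \<Sum>i\<in>UNIV. x $ i *\<^sub>R axis i (1::real)) = (\<lambda>x. x)"
    by (simp add: fun_eq_iff vec_eq_iff axis_def if_distrib cong: if_cong)
  ultimately have id: "integrable ?R (\<lambda>x. x)" by simp
  have mean: "(\<integral>x. x \<partial>?R) = 0"
    using integral_bounded_linear[OF bounded_linear_vec_nth id] mi(2) by (simp add: vec_eq_iff)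
  have "covariance_matrix ?R = K + L"
    by (simp only: covariance_matrix_def mean zero_index diff_0_right m2) (simp add: vec_eq_iff)
  moreover have "prob_space ?R" by (rule PQ.prob_space_distr) measurable
  ultimately show ?thesis
    by (simp add: centered_laws_def mean integrable_norm_power2I m2)
qed

section \<open>Bounds on the mutual information\<close>

text \<open>Donsker-Varadhan bound for a positive test function of total mass at most 1. With
  \<open>D\<close> the density of \<open>N\<close> relative to \<open>M\<close>, the inequality
  \<open>ln (f / D) \<le> f / D - 1\<close> is integrated against \<open>N\<close>, where
  \<open>f / D\<close> has mean at most 1. When \<open>KL_ext\<close> is infinite there is nothing
  to prove.\<close>

lemma KL_ext_ge:
  assumes M: "sigma_finite_measure M" and N: "prob_space N" and [measurable_cong]: "sets N = sets M" and b: "1 < b"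
    and [measurable]: "f \<in> borel_measurable M" and pos: "\<And>x. 0 < f x"
    and le1: "(\<integral>\<^sup>+x. ennreal (f x) \<partial>M) \<le> 1"
    and int: "integrable N (\<lambda>x. log b (f x))"
  shows "ereal (\<integral>x. log b (f x) \<partial>N) \<le> KL_ext b M N"
proof (cases "absolutely_continuous M N \<and> integrable N (entropy_density b M N)")
  case True
  then have ac: "absolutely_continuous M N" and ie: "integrable N (entropy_density b M N)" by auto
  interpret M: sigma_finite_measure M by fact
  interpret N: prob_space N by fact
  obtain D where D: "D \<in> borel_measurable M" "AE x in M. RN_deriv M N x = ennreal (D x)"
      "AE x in N. 0 < D x" "\<And>x. 0 \<le> D x"
    using M.real_RN_deriv[OF N.finite_measure_axioms ac assms(3)] by blast
  note [measurable] = D(1)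
  have "N = density M (RN_deriv M N)"
    using ac by (rule M.density_RN_deriv[symmetric]) fact
  also have "\<dots> = density M D"
    using D by (auto intro!: density_cong)
  finally have ND: "N = density M D" .
  have "(\<integral>\<^sup>+x. ennreal (f x / D x) \<partial>N) = (\<integral>\<^sup>+x. ennreal (D x) * ennreal (f x / D x) \<partial>M)"
    by (subst ND) (simp add: nn_integral_density)
  \<comment> \<open>Only an inequality, since the mass of \<open>f\<close> on the set where
    \<open>D\<close> vanishes is lost.\<close>
  also have "\<dots> \<le> (\<integral>\<^sup>+x. ennreal (f x) \<partial>M)"
    using D(4) pos[THEN less_imp_le] by (intro nn_integral_mono) (auto simp: ennreal_mult[symmetric])
  finally have g1: "(\<integral>\<^sup>+x. ennreal (f x / D x) \<partial>N) \<le> 1" using le1 by (rule order_trans)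
  have gnn: "0 \<le> f x / D x" for x using D(4) pos[THEN less_imp_le] by simp
  have gi: "integrable N (\<lambda>x. f x / D x)"
    using g1 gnn by (intro integrableI_nonneg) (auto simp: less_top[symmetric] top_unique)
  have g2: "(\<integral>x. f x / D x \<partial>N) \<le> 1"
    using g1 gnn by (subst integral_eq_nn_integral) (auto intro!: enn2real_leI)
  have "AE x in N. log b (f x) - entropy_density b M N x \<le> (f x / D x - 1) / ln b"
    using absolutely_continuous_AE[OF assms(3) ac D(2)] D(3)
  proof eventually_elim
    fix x assume x: "RN_deriv M N x = ennreal (D x)" "0 < D x"
    have "ln (f x) - ln (D x) = ln (f x / D x)" using x(2) pos[of x] by (simp add: ln_div)
    also have "\<dots> \<le> f x / D x - 1" using x(2) pos[of x] by (intro ln_le_minus_one) simp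
    finally have "(ln (f x) - ln (D x)) / ln b \<le> (f x / D x - 1) / ln b"
      using b by (intro divide_right_mono) auto
    then show "log b (f x) - entropy_density b M N x \<le> (f x / D x - 1) / ln b"
      using x D(4) by (simp add: entropy_density_def log_def diff_divide_distrib)
  qed
  then have "(\<integral>x. log b (f x) - entropy_density b M N x \<partial>N) \<le> (\<integral>x. (f x / D x - 1) / ln b \<partial>N)"
    by (intro integral_mono_AE) (auto intro!: int ie gi)
  also have "\<dots> \<le> 0"
    using g2 b by (simp add: gi N.prob_space divide_le_0_iff)
  finally show ?thesis
    using True int ie by (simp add: KL_ext_def KL_divergence_def)
qed (auto simp: KL_ext_def)

lemma additive_info_eq:
  fixes P Q :: "(real^'n) measure"
  assumes P: "prob_space P" "sets P = sets borel" and Q: "prob_space Q" "sets Q = sets borel"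
  shows "additive_info P Q = KL_ext 2 (P \<Otimes>\<^sub>M distr (P \<Otimes>\<^sub>M Q) borel (\<lambda>(x, y). x + y))
    (distr (P \<Otimes>\<^sub>M Q) (borel \<Otimes>\<^sub>M borel) (\<lambda>(x, y). (x, x + y)))"
proof -
  interpret Q: prob_space Q by fact
  have "distr (P \<Otimes>\<^sub>M Q) borel fst = distr (P \<Otimes>\<^sub>M Q) P fst"
    by (rule distr_cong) (simp_all add: P)
  then have "distr (P \<Otimes>\<^sub>M Q) borel fst = P" by (simp add: Q.distr_pair_fst)
  then show ?thesis
    by (simp add: additive_info_def mutual_info_def split_beta')
qed

section \<open>Gaussian densities and their expected logarithms\<close>

lemma gauss_dens_pos: "0 < gauss_dens K y" if "pos_def K" for K :: "real^'n^'n"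
  using det_pos_def[OF that] by (simp add: gauss_dens_def less_imp_neq[symmetric])

lemma gauss_dens_le: "pos_def K \<Longrightarrow> gauss_dens K y \<le> gauss_dens K 0"
  by (erule pos_def_factorization) (auto simp: gauss_dens_def intro!: divide_right_mono)

lemma continuous_gauss_dens: "continuous_on UNIV (gauss_dens K)"
  unfolding gauss_dens_def divide_inverse
  by (intro continuous_intros linear_continuous_on_compose[OF _ matrix_vector_mul_linear])

text \<open>For positive definite \<open>K\<close> this is the mean of
  \<open>log 2 (gauss_dens K y)\<close> under any centered law of covariance \<open>L\<close>, that
  is, minus a cross-entropy in bits. \<open>K\<close> is the reference covariance and
  \<open>L\<close> the actual one.\<close>

definition log_gauss_mean :: "real^'n^'n \<Rightarrow> real^'n^'n \<Rightarrow> real" where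
  "log_gauss_mean K L = - log 2 (sqrt (2 * pi) ^ CARD('n) * sqrt (det K)) - trace (matrix_inv K ** L) / (2 * ln 2)"

lemma log_gauss_dens_centered_laws:
  fixes K L :: "real^'n^'n"
  assumes P: "P \<in> centered_laws L" and K: "pos_def K"
  shows "integrable P (\<lambda>y. log 2 (gauss_dens K y))"
    and "(\<integral>y. log 2 (gauss_dens K y) \<partial>P) = log_gauss_mean K L"
proof -
  interpret prob_space P using P by (rule centered_lawsD)
  let ?c = "sqrt (2 * pi) ^ CARD('n) * sqrt (det K)"
  have "0 < ?c" using det_pos_def[OF K] by simp
  then have eq: "log 2 (gauss_dens K y) = - log 2 ?c - (y \<bullet> (matrix_inv K *v y)) / (2 * ln 2)" for y
    unfolding gauss_dens_def log_def by (subst ln_div) (auto simp: field_simps)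
  note q = centered_laws_quadratic_form[OF P, of "matrix_inv K"]
  show "integrable P (\<lambda>y. log 2 (gauss_dens K y))" "(\<integral>y. log 2 (gauss_dens K y) \<partial>P) = log_gauss_mean K L"
    unfolding eq log_gauss_mean_def by (simp_all add: q prob_space)
qed

section \<open>Output density under Gaussian noise\<close>

lemma nn_integral_gaussian_shift:
  fixes L :: "real^'n^'n"
  assumes "pos_def L" and [measurable]: "g \<in> borel_measurable borel"
  shows "(\<integral>\<^sup>+y. g (x + y) \<partial>gaussian L) = (\<integral>\<^sup>+s. ennreal (gauss_dens L (s - x)) * g s \<partial>lborel)"
proof -
  have "(\<integral>\<^sup>+s. ennreal (gauss_dens L (s - x)) * g s \<partial>lborel) =
      (\<integral>\<^sup>+s. ennreal (gauss_dens L (s - x)) * g s \<partial>distr lborel borel ((+) x))"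
    by (simp add: lborel_distr_plus)
  then show ?thesis
    by (simp add: gaussian_density[OF assms(1)] nn_integral_density nn_integral_distr)
qed

text \<open>The density of \<open>X + Y\<close> for \<open>X\<close> with law \<open>P\<close> and
  Gaussian noise of positive definite covariance \<open>L\<close>. The convolution integral fixes a
  version at every point, and this version is positive, bounded by the peak of the noise density,
  and continuous.\<close>

definition output_dens :: "(real^'n) measure \<Rightarrow> real^'n^'n \<Rightarrow> real^'n \<Rightarrow> real" where
  "output_dens P L s = (\<integral>x. gauss_dens L (s - x) \<partial>P)"

context
  fixes P :: "(real^'n) measure" and L :: "real^'n^'n"
  assumes P: "prob_space P" and sets_P [measurable_cong]: "sets P = sets borel" and L: "pos_def L"
begin

interpretation P: prob_space P by (rule P)
interpretation Q: prob_space "gaussian L" by (rule prob_space_gaussian)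
interpretation PQ: pair_prob_space P "gaussian L" ..

lemma integrable_gauss_dens_shift: "integrable P (\<lambda>x. gauss_dens L (s - x))"
  using gauss_dens_pos[OF L] gauss_dens_le[OF L]
  by (intro P.integrable_const_bound[where B="gauss_dens L 0"]) (auto simp: abs_of_pos)

lemma nn_integral_gauss_dens_shift: "(\<integral>\<^sup>+x. ennreal (gauss_dens L (s - x)) \<partial>P) = ennreal (output_dens P L s)"
  unfolding output_dens_def using gauss_dens_pos[OF L]
  by (intro nn_integral_eq_integral integrable_gauss_dens_shift) (auto simp: less_imp_le)

lemma output_dens_pos: "0 < output_dens P L s"
proof -
  have "ennreal (gauss_dens L (s - x)) \<noteq> 0" for x
    using gauss_dens_pos[OF L, of "s - x"] by simp
  then have "(\<integral>\<^sup>+x. ennreal (gauss_dens L (s - x)) \<partial>P) \<noteq> 0"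
    by (subst nn_integral_0_iff_AE) (auto simp: P.AE_False)
  then have "ennreal (output_dens P L s) \<noteq> 0"
    by (simp only: nn_integral_gauss_dens_shift not_False_eq_True)
  then show ?thesis by (metis ennreal_eq_0_iff not_le)
qed

lemma output_dens_le: "output_dens P L s \<le> gauss_dens L 0"
proof -
  have "output_dens P L s \<le> (\<integral>x. gauss_dens L 0 \<partial>P)"
    unfolding output_dens_def using gauss_dens_le[OF L]
    by (intro integral_mono integrable_gauss_dens_shift) auto
  then show ?thesis by (simp add: P.prob_space)
qed

text \<open>Dominated convergence, the dominating constant being the peak
  \<open>gauss_dens L 0\<close>.\<close>

lemma continuous_output_dens: "continuous_on UNIV (output_dens P L)"
  unfolding continuous_on_eq_continuous_at[OF open_UNIV] continuous_at_sequentially comp_def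
proof safe
  fix a :: "real^'n" and u assume u: "u \<longlonglongrightarrow> a"
  show "(\<lambda>n. output_dens P L (u n)) \<longlonglongrightarrow> output_dens P L a"
    unfolding output_dens_def
  proof (rule integral_dominated_convergence[where w="\<lambda>_. gauss_dens L 0"])
    have "(\<lambda>n. gauss_dens L (u n - x)) \<longlonglongrightarrow> gauss_dens L (a - x)" for x
      using continuous_gauss_dens[of L] u
      by (intro isCont_tendsto_compose[where g="gauss_dens L"] tendsto_diff tendsto_const)
        (auto simp: continuous_on_eq_continuous_at)
    then show "AE x in P. (\<lambda>n. gauss_dens L (u n - x)) \<longlonglongrightarrow> gauss_dens L (a - x)" by simp
    show "AE x in P. norm (gauss_dens L (u n - x)) \<le> gauss_dens L 0" for n
      using gauss_dens_pos[OF L] gauss_dens_le[OF L] by (auto simp: abs_of_pos)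
  qed auto
qed

lemma output_dens_measurable [measurable]: "output_dens P L \<in> borel_measurable borel"
  using continuous_output_dens by (rule borel_measurable_continuous_onI)

lemma output_law: "distr (P \<Otimes>\<^sub>M gaussian L) borel (\<lambda>(x, y). x + y) = density lborel (output_dens P L)"
proof (rule measure_eqI)
  fix S assume "S \<in> sets (distr (P \<Otimes>\<^sub>M gaussian L) borel (\<lambda>(x, y). x + y))"
  then have [measurable]: "S \<in> sets borel" by simp
  interpret PL: pair_sigma_finite P "lborel :: (real^'n) measure" ..
  have "emeasure (distr (P \<Otimes>\<^sub>M gaussian L) borel (\<lambda>(x, y). x + y)) S
      = (\<integral>\<^sup>+s. indicator S s \<partial>distr (P \<Otimes>\<^sub>M gaussian L) borel (\<lambda>(x, y). x + y))"
    by simp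
  also have "\<dots> = (\<integral>\<^sup>+z. indicator S (fst z + snd z) \<partial>(P \<Otimes>\<^sub>M gaussian L))"
    by (subst nn_integral_distr) (auto simp: split_beta')
  also have "\<dots> = (\<integral>\<^sup>+x. \<integral>\<^sup>+y. indicator S (x + y) \<partial>gaussian L \<partial>P)"
    by (subst Q.nn_integral_fst[symmetric]) auto
  also have "\<dots> = (\<integral>\<^sup>+x. \<integral>\<^sup>+s. ennreal (gauss_dens L (s - x)) * indicator S s \<partial>lborel \<partial>P)"
    by (subst nn_integral_gaussian_shift[OF L]) auto
  also have "\<dots> = (\<integral>\<^sup>+s. \<integral>\<^sup>+x. ennreal (gauss_dens L (s - x)) * indicator S s \<partial>P \<partial>lborel)"
    by (rule PL.Fubini'[symmetric]) measurable
  also have "\<dots> = (\<integral>\<^sup>+s. ennreal (output_dens P L s) * indicator S s \<partial>lborel)"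
    by (simp add: nn_integral_multc nn_integral_gauss_dens_shift)
  finally show "emeasure (distr (P \<Otimes>\<^sub>M gaussian L) borel (\<lambda>(x, y). x + y)) S = emeasure (density lborel (output_dens P L)) S"
    by (simp add: emeasure_density)
qed simp

text \<open>Given \<open>x\<close>, the output has Lebesgue density
  \<open>gauss_dens L (s - x)\<close>; dividing by the positive output density passes from Lebesgue
  measure to the output law. The input law may be singular.\<close>

lemma joint_law:
  "distr (P \<Otimes>\<^sub>M gaussian L) (borel \<Otimes>\<^sub>M borel) (\<lambda>(x, y). (x, x + y)) =
    density (P \<Otimes>\<^sub>M distr (P \<Otimes>\<^sub>M gaussian L) borel (\<lambda>(x, y). x + y))
      (\<lambda>(x, s). ennreal (gauss_dens L (s - x) / output_dens P L s))" (is "?J = density (P \<Otimes>\<^sub>M ?R) ?f")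
proof (rule measure_eqI)
  interpret R: prob_space ?R by (rule PQ.prob_space_distr) measurable
  show "sets ?J = sets (density (P \<Otimes>\<^sub>M ?R) ?f)" by (simp cong: sets_pair_measure_cong add: sets_P)
  fix S assume "S \<in> sets ?J"
  then have [measurable]: "S \<in> sets (borel \<Otimes>\<^sub>M borel)" by simp
  have cancel: "ennreal (output_dens P L s) * (ennreal (gauss_dens L (s - x) / output_dens P L s) * c) =
      ennreal (gauss_dens L (s - x)) * c" for s x c
    using output_dens_pos[of s] gauss_dens_pos[OF L, of "s - x"]
    by (simp add: mult.assoc[symmetric] ennreal_mult[symmetric])
  have "emeasure ?J S = (\<integral>\<^sup>+z. indicator S z \<partial>?J)"
    by simp
  also have "\<dots> = (\<integral>\<^sup>+z. indicator S (fst z, fst z + snd z) \<partial>(P \<Otimes>\<^sub>M gaussian L))"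
    by (subst nn_integral_distr) (auto simp: split_beta')
  also have "\<dots> = (\<integral>\<^sup>+x. \<integral>\<^sup>+y. indicator S (x, x + y) \<partial>gaussian L \<partial>P)"
    by (subst Q.nn_integral_fst[symmetric]) auto
  also have "\<dots> = (\<integral>\<^sup>+x. \<integral>\<^sup>+s. ennreal (gauss_dens L (s - x)) * indicator S (x, s) \<partial>lborel \<partial>P)"
    by (intro nn_integral_cong nn_integral_gaussian_shift[OF L, where g="\<lambda>s. indicator S (_, s)"]) measurable
  also have "\<dots> = (\<integral>\<^sup>+x. \<integral>\<^sup>+s. ?f (x, s) * indicator S (x, s) \<partial>?R \<partial>P)"
    unfolding output_law by (simp add: nn_integral_density cancel)
  also have "\<dots> = (\<integral>\<^sup>+z. ?f z * indicator S z \<partial>(P \<Otimes>\<^sub>M ?R))"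
    by (rule R.nn_integral_fst) measurable
  finally show "emeasure ?J S = emeasure (density (P \<Otimes>\<^sub>M ?R) ?f) S"
    by (subst emeasure_density) auto
qed

end

text \<open>Uniqueness of densities gives the identity almost everywhere only; continuity extends it to
  every \<open>s\<close>, which is needed when the law of \<open>X + Y\<close> is not absolutely continuous.\<close>

lemma gaussian_output_dens:
  fixes K L :: "real^'n^'n"
  assumes K: "psd K" and L: "pos_def L"
  shows "output_dens (gaussian K) L s = gauss_dens (K + L) s"
proof -
  note G = prob_space_gaussian[of K] sets_gaussian[of K] L
  have KL: "pos_def (K + L)" by (rule psd_add_pos_def[OF K L])
  note [measurable] = output_dens_measurable[OF G]
  have "density lborel (output_dens (gaussian K) L) = gaussian (K + L)"
    unfolding output_law[OF G, symmetric] by (rule gaussian_convolution[OF K pos_def_imp_psd[OF L]])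
  also have "\<dots> = density lborel (gauss_dens (K + L))" by (rule gaussian_density[OF KL])
  finally have "AE s in lborel. ennreal (output_dens (gaussian K) L s) = ennreal (gauss_dens (K + L) s)"
    by (intro sigma_finite_measure.density_unique[OF sigma_finite_lborel]) auto
  then have AE: "AE s in lborel. output_dens (gaussian K) L s = gauss_dens (K + L) s"
    by eventually_elim (simp add: output_dens_pos[OF G] gauss_dens_pos[OF KL] less_imp_le)
  define U where "U = {s. output_dens (gaussian K) L s \<noteq> gauss_dens (K + L) s}"
  have "open U"
    unfolding U_def by (intro open_Collect_neq continuous_output_dens[OF G] continuous_gauss_dens)
  have "U = {}"
  proof (rule ccontr)
    assume "U \<noteq> {}"
    then obtain a where "a \<in> U" by auto
    with \<open>open U\<close> obtain e where e: "0 < e" "ball a e \<subseteq> U" by (meson open_contains_ball)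
    have "emeasure lborel U = 0"
    proof (rule AE_iff_measurable[THEN iffD1, OF _ _ AE])
      show "U \<in> sets lborel" using \<open>open U\<close> by simp
    qed (simp add: U_def)
    then have "emeasure lborel (ball a e) = 0"
      using emeasure_mono[OF e(2), of lborel] \<open>open U\<close> by simp
    then show False
      using e(1) unit_ball_vol_pos[of "real CARD('n)"] by (simp add: emeasure_ball)
  qed
  then show ?thesis by (auto simp: U_def)
qed

text \<open>\<open>L\<close> is the reference noise covariance and \<open>L'\<close> the actual one,
  possibly singular. The quotient \<open>?f\<close> is a test function for \<open>KL_ext_ge\<close>:
  integrating out the Gaussian input gives 1 at each \<open>s\<close>, whatever the output law, and
  its expected logarithm splits into a noise term and an output term.\<close>

lemma additive_info_gaussian_input_ge:
  fixes K L :: "real^'n^'n"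
  assumes K: "psd K" and L: "pos_def L" and Q: "Q \<in> centered_laws L'"
  shows "ereal (log_gauss_mean L L' - log_gauss_mean (K + L) (K + L')) \<le> additive_info (gaussian K) Q"
proof -
  let ?P = "gaussian K" and ?f = "\<lambda>(x, s). gauss_dens L (s - x) / gauss_dens (K + L) s"
  let ?R = "distr (?P \<Otimes>\<^sub>M Q) borel (\<lambda>(x, y). x + y)"
  let ?J = "distr (?P \<Otimes>\<^sub>M Q) (borel \<Otimes>\<^sub>M borel) (\<lambda>(x, y). (x, x + y))"
  note [measurable_cong] = centered_lawsD(2)[OF Q]
  have KL: "pos_def (K + L)" by (rule psd_add_pos_def[OF K L])
  interpret P: prob_space ?P by (rule prob_space_gaussian)
  interpret Q: prob_space Q using Q by (rule centered_lawsD)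
  interpret PQ: pair_prob_space ?P Q ..
  interpret R: prob_space ?R by (rule PQ.prob_space_distr) measurable
  interpret PR: pair_prob_space ?P ?R ..
  have R: "?R \<in> centered_laws (K + L')"
    by (rule centered_laws_convolution[OF gaussian_in_centered_laws[OF K] Q])
  have 1: "(\<integral>\<^sup>+z. ennreal (?f z) \<partial>(?P \<Otimes>\<^sub>M ?R)) = 1"
  proof -
    \<comment> \<open>The identity is established at every \<open>s\<close>, because the output law
      \<open>?R\<close> may be singular and then ignores statements that hold Lebesgue-almost
      everywhere.\<close>
    have "(\<integral>\<^sup>+x. ennreal (?f (x, s)) \<partial>?P) = 1" for s
    proof -
      have "(\<integral>\<^sup>+x. ennreal (?f (x, s)) \<partial>?P) = (\<integral>\<^sup>+x. ennreal (gauss_dens L (s - x)) * ennreal (1 / gauss_dens (K + L) s) \<partial>?P)"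
        using gauss_dens_pos[OF L] gauss_dens_pos[OF KL]
        by (intro nn_integral_cong) (simp add: ennreal_mult[symmetric] less_imp_le)
      also have "\<dots> = ennreal (gauss_dens (K + L) s) * ennreal (1 / gauss_dens (K + L) s)"
        using nn_integral_gauss_dens_shift[OF prob_space_gaussian[of K] sets_gaussian[of K] L, of s]
        by (subst nn_integral_multc) (auto simp: gaussian_output_dens[OF K L])
      also have "\<dots> = 1"
        using gauss_dens_pos[OF KL, of s] by (simp add: ennreal_mult[symmetric])
      finally show ?thesis .
    qed
    moreover have "(\<integral>\<^sup>+z. ennreal (?f z) \<partial>(?P \<Otimes>\<^sub>M ?R)) = (\<integral>\<^sup>+s. \<integral>\<^sup>+x. ennreal (?f (x, s)) \<partial>?P \<partial>?R)"
      by (rule PR.nn_integral_snd[symmetric]) measurable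
    ultimately show ?thesis by (simp add: R.emeasure_space_1[simplified])
  qed
  have fpos: "0 < ?f z" for z using gauss_dens_pos[OF L] gauss_dens_pos[OF KL] by (simp add: split_beta')
  have logf: "log 2 (?f (x, x + y)) = log 2 (gauss_dens L y) - log 2 (gauss_dens (K + L) (x + y))" for x y
    using gauss_dens_pos[OF L, of y] gauss_dens_pos[OF KL, of "x + y"] by (simp add: log_divide_pos)
  note g1 = log_gauss_dens_centered_laws[OF Q L] and g2 = log_gauss_dens_centered_laws[OF R KL]
  have i1: "integrable (?P \<Otimes>\<^sub>M Q) (\<lambda>z. log 2 (gauss_dens L (snd z)))"
    "(\<integral>z. log 2 (gauss_dens L (snd z)) \<partial>(?P \<Otimes>\<^sub>M Q)) = log_gauss_mean L L'"
    using PQ.integral_comp_snd[OF g1(1)] g1(2) by auto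
  have i2: "integrable (?P \<Otimes>\<^sub>M Q) (\<lambda>z. log 2 (gauss_dens (K + L) (fst z + snd z)))"
    "(\<integral>z. log 2 (gauss_dens (K + L) (fst z + snd z)) \<partial>(?P \<Otimes>\<^sub>M Q)) = log_gauss_mean (K + L) (K + L')"
    using g2 by (simp_all add: integrable_distr_eq integral_distr split_beta')
  have int: "integrable ?J (\<lambda>z. log 2 (?f z))"
    and val: "(\<integral>z. log 2 (?f z) \<partial>?J) = log_gauss_mean L L' - log_gauss_mean (K + L) (K + L')"
    using i1 i2 by (simp_all add: integrable_distr_eq integral_distr split_beta' logf[simplified])
  have "ereal (\<integral>z. log 2 (?f z) \<partial>?J) \<le> KL_ext 2 (?P \<Otimes>\<^sub>M ?R) ?J"
  proof (rule KL_ext_ge)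
    show "sigma_finite_measure (?P \<Otimes>\<^sub>M ?R)" by (rule PR.sigma_finite_measure_axioms)
    show "prob_space ?J" by (rule PQ.prob_space_distr) measurable
    show "sets ?J = sets (?P \<Otimes>\<^sub>M ?R)" by (simp cong: sets_pair_measure_cong)
    show "?f \<in> borel_measurable (?P \<Otimes>\<^sub>M ?R)" by measurable
    show "(\<integral>\<^sup>+z. ennreal (?f z) \<partial>(?P \<Otimes>\<^sub>M ?R)) \<le> 1" unfolding 1 by simp
  qed (auto simp: int fpos simp del: split_paired_All)
  then show ?thesis
    unfolding val additive_info_eq[OF prob_space_gaussian sets_gaussian centered_lawsD(1,2)[OF Q]] .
qed

text \<open>The information is the mean log noise density minus the mean log output density, and
  Gibbs' inequality against \<open>gauss_dens \<Sigma>\<close> bounds the latter from below. Leaving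
  \<open>\<Sigma>\<close> free lets one bound serve both the exact covariance sum and a fixed scalar
  reference.\<close>

lemma additive_info_gaussian_noise_le:
  fixes L \<Sigma> :: "real^'n^'n"
  assumes P: "P \<in> centered_laws K" and L: "pos_def L" and \<Sigma>: "pos_def \<Sigma>"
  shows "additive_info P (gaussian L) \<le> ereal (log_gauss_mean L L - log_gauss_mean \<Sigma> (K + L))"
proof -
  let ?Q = "gaussian L" and ?h = "output_dens P L"
  let ?f = "\<lambda>(x, s). gauss_dens L (s - x) / ?h s"
  let ?R = "distr (P \<Otimes>\<^sub>M ?Q) borel (\<lambda>(x, y). x + y)"
  let ?J = "distr (P \<Otimes>\<^sub>M ?Q) (borel \<Otimes>\<^sub>M borel) (\<lambda>(x, y). (x, x + y))"
  let ?M = "P \<Otimes>\<^sub>M ?R"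
  note G = centered_lawsD(1,2)[OF P] L
  note [measurable_cong] = centered_lawsD(2)[OF P]
  note [measurable] = output_dens_measurable[OF G]
  interpret P: prob_space P using P by (rule centered_lawsD)
  interpret Q: prob_space ?Q by (rule prob_space_gaussian)
  interpret PQ: pair_prob_space P ?Q ..
  interpret R: prob_space ?R by (rule PQ.prob_space_distr) measurable
  interpret PR: pair_prob_space P ?R ..
  have hpos: "0 < ?h s" for s by (rule output_dens_pos[OF G])
  have Q: "?Q \<in> centered_laws L" by (rule gaussian_in_centered_laws[OF pos_def_imp_psd[OF L]])
  have R: "?R \<in> centered_laws (K + L)" by (rule centered_laws_convolution[OF P Q])
  note g1 = log_gauss_dens_centered_laws[OF Q L] and g2 = log_gauss_dens_centered_laws[OF R \<Sigma>]
  have fM: "?f \<in> borel_measurable ?M" by measurable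
  have J: "?J = density ?M (\<lambda>z. ennreal (?f z))"
    using joint_law[OF G] by (simp add: split_beta')
  have ac: "absolutely_continuous ?M ?J"
    unfolding J using fM by (intro absolutely_continuousI_density) auto
  \<comment> \<open>Being a density of \<open>?J\<close>, \<open>?f\<close> agrees almost everywhere
    with the Radon-Nikodym derivative behind \<open>KL_ext\<close>.\<close>
  have "AE z in ?M. ennreal (?f z) = RN_deriv ?M ?J z"
    using fM by (intro PR.RN_deriv_unique J[symmetric]) auto
  from absolutely_continuous_AE[OF _ ac this]
  have "AE z in ?J. ennreal (?f z) = RN_deriv ?M ?J z"
    by (simp cong: sets_pair_measure_cong add: centered_lawsD(2)[OF P])
  then have ed: "AE z in ?J. entropy_density 2 ?M ?J z = log 2 (?f z)"
  proof eventually_elim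
    fix z assume "ennreal (?f z) = RN_deriv ?M ?J z"
    moreover have "0 \<le> ?f z" using gauss_dens_pos[OF L] hpos by (simp add: split_beta' less_imp_le)
    ultimately show "entropy_density 2 ?M ?J z = log 2 (?f z)"
      by (simp add: entropy_density_def flip: \<open>ennreal (?f z) = RN_deriv ?M ?J z\<close>)
  qed
  have g: "integrable ?R (\<lambda>s. gauss_dens \<Sigma> s / ?h s)" "(\<integral>s. gauss_dens \<Sigma> s / ?h s \<partial>?R) = 1"
  proof -
    have "(\<integral>\<^sup>+s. ennreal (gauss_dens \<Sigma> s / ?h s) \<partial>?R) = (\<integral>\<^sup>+s. ennreal (gauss_dens \<Sigma> s) \<partial>lborel)"
      unfolding output_law[OF G] using hpos gauss_dens_pos[OF \<Sigma>]
      by (subst nn_integral_density) (auto simp: ennreal_mult[symmetric] less_imp_le less_imp_neq[OF hpos, symmetric])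
    also have "\<dots> = 1"
      using prob_space.emeasure_space_1[OF prob_space_gaussian[of \<Sigma>]]
      by (simp add: gaussian_density[OF \<Sigma>] emeasure_density)
    finally have 1: "(\<integral>\<^sup>+s. ennreal (gauss_dens \<Sigma> s / ?h s) \<partial>?R) = 1" .
    moreover have nn: "0 \<le> gauss_dens \<Sigma> s / ?h s" for s
      using hpos[of s] gauss_dens_pos[OF \<Sigma>, of s] by simp
    ultimately show "integrable ?R (\<lambda>s. gauss_dens \<Sigma> s / ?h s)"
      by (intro integrableI_nonneg) auto
    show "(\<integral>s. gauss_dens \<Sigma> s / ?h s \<partial>?R) = 1"
      using 1 nn by (subst integral_eq_nn_integral) auto
  qed
  \<comment> \<open>A pointwise form of Gibbs' inequality, from \<open>ln r \<le> r - 1\<close> with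
    \<open>r\<close> the quotient of the two densities. Since \<open>r\<close> has mean 1 under
    \<open>?R\<close>, the correction has mean 0 and \<open>?l\<close> keeps the mean of the
    reference log density.\<close>
  let ?l = "\<lambda>s. log 2 (gauss_dens \<Sigma> s) + (1 - gauss_dens \<Sigma> s / ?h s) / ln 2"
  have lower: "?l s \<le> log 2 (?h s)" for s
  proof -
    have "ln (gauss_dens \<Sigma> s) - ln (?h s) = ln (gauss_dens \<Sigma> s / ?h s)"
      using hpos[of s] gauss_dens_pos[OF \<Sigma>, of s] by (simp add: ln_div)
    also have "\<dots> \<le> gauss_dens \<Sigma> s / ?h s - 1"
      using hpos gauss_dens_pos[OF \<Sigma>] by (intro ln_le_minus_one) simp
    finally have "(ln (gauss_dens \<Sigma> s) + (1 - gauss_dens \<Sigma> s / ?h s)) / ln 2 \<le> ln (?h s) / ln 2"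
      by (intro divide_right_mono) auto
    then show ?thesis by (simp add: log_def add_divide_distrib)
  qed
  \<comment> \<open>Together with \<open>lower\<close> this encloses the log output density between
    integrable functions, so that its mean is finite and the logarithm of \<open>?f\<close> may be
    split.\<close>
  have upper: "log 2 (?h s) \<le> log 2 (gauss_dens L 0)" for s
    using hpos output_dens_le[OF G] gauss_dens_pos[OF L] by simp
  have li: "integrable ?R ?l" "(\<integral>s. ?l s \<partial>?R) = log_gauss_mean \<Sigma> (K + L)"
    using g g2 R.prob_space by simp_all
  have hi: "integrable ?R (\<lambda>s. log 2 (?h s))"
  proof (rule Bochner_Integration.integrable_bound)
    show "integrable ?R (\<lambda>s. \<bar>?l s\<bar> + \<bar>log 2 (gauss_dens L 0)\<bar>)"
      by (intro Bochner_Integration.integrable_add integrable_abs li) simp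
    show "AE s in ?R. norm (log 2 (?h s)) \<le> norm (\<bar>?l s\<bar> + \<bar>log 2 (gauss_dens L 0)\<bar>)"
    proof (rule AE_I2)
      fix s
      show "norm (log 2 (?h s)) \<le> norm (\<bar>?l s\<bar> + \<bar>log 2 (gauss_dens L 0)\<bar>)"
        using lower[of s] upper[of s] unfolding real_norm_def by linarith
    qed
  qed measurable
  have hm: "log_gauss_mean \<Sigma> (K + L) \<le> (\<integral>s. log 2 (?h s) \<partial>?R)"
    unfolding li(2)[symmetric] by (intro integral_mono li hi lower)
  have i1: "integrable (P \<Otimes>\<^sub>M ?Q) (\<lambda>z. log 2 (gauss_dens L (snd z)))"
    "(\<integral>z. log 2 (gauss_dens L (snd z)) \<partial>(P \<Otimes>\<^sub>M ?Q)) = log_gauss_mean L L"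
    using PQ.integral_comp_snd[OF g1(1)] g1(2) by auto
  have i2: "integrable (P \<Otimes>\<^sub>M ?Q) (\<lambda>z. log 2 (?h (fst z + snd z)))"
    "(\<integral>z. log 2 (?h (fst z + snd z)) \<partial>(P \<Otimes>\<^sub>M ?Q)) = (\<integral>s. log 2 (?h s) \<partial>?R)"
    using hi by (simp_all add: integrable_distr_eq integral_distr split_beta')
  have logf: "log 2 (?f (x, x + y)) = log 2 (gauss_dens L y) - log 2 (?h (x + y))" for x y
    using gauss_dens_pos[OF L, of y] hpos[of "x + y"] by (simp add: log_divide_pos)
  have int: "integrable ?J (\<lambda>z. log 2 (?f z))"
    and val: "(\<integral>z. log 2 (?f z) \<partial>?J) = log_gauss_mean L L - (\<integral>s. log 2 (?h s) \<partial>?R)"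
    using i1 i2 by (simp_all add: integrable_distr_eq integral_distr split_beta' logf[simplified])
  have em [measurable]: "entropy_density 2 ?M ?J \<in> borel_measurable ?J"
    using measurable_entropy_density[of 2 ?M ?J] by (simp add: J)
  have "integrable ?J (entropy_density 2 ?M ?J)"
    using int ed fM by (subst integrable_cong_AE[OF _ _ ed]) (auto simp: J)
  moreover have "KL_divergence 2 ?M ?J = (\<integral>z. log 2 (?f z) \<partial>?J)"
    unfolding KL_divergence_def using fM by (intro integral_cong_AE ed) (auto simp: J)
  ultimately have "additive_info P ?Q = ereal (\<integral>z. log 2 (?f z) \<partial>?J)"
    using ac by (simp add: additive_info_eq[OF G(1,2) prob_space_gaussian sets_gaussian] KL_ext_def)
  then show ?thesis using hm by (simp add: val)
qed

section \<open>The saddle points\<close>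

lemma trace_mat_1: "trace (mat 1 :: real^'n^'n) = CARD('n)"
  by (simp add: trace_def mat_def)

lemma trace_scaleR: "trace (c *\<^sub>R A) = c * trace A" for A :: "real^'n^'n"
  by (simp add: trace_def sum_distrib_left)

lemma log_gauss_mean_self:
  fixes K :: "real^'n^'n"
  assumes "pos_def K"
  shows "log_gauss_mean K K = - log 2 (sqrt (2 * pi) ^ CARD('n) * sqrt (det K)) - CARD('n) / (2 * ln 2)"
  by (simp add: log_gauss_mean_def matrix_inv_cancel pos_def_invertible assms trace_mat_1)

text \<open>When reference and actual covariance agree, the trace term depends on the dimension
  alone. The two trace terms cancel, leaving half the logarithm of
  \<open>det (K + L) / det L\<close>.\<close>

lemma log_gauss_mean_diff:
  fixes K L :: "real^'n^'n"
  assumes K: "psd K" and L: "pos_def L"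
  shows "log_gauss_mean L L - log_gauss_mean (K + L) (K + L) = 1/2 * log 2 (det (mat 1 + matrix_inv L ** K))"
proof -
  have KL: "pos_def (K + L)" by (rule psd_add_pos_def[OF K L])
  note inv = matrix_inv_cancel(2)[OF pos_def_invertible[OF L]]
  have "det (matrix_inv L) * det L = 1"
    using inv by (metis det_I det_mul)
  then have di: "det (matrix_inv L) = 1 / det L"
    using det_pos_def[OF L] by (simp add: field_simps)
  have "mat 1 + matrix_inv L ** K = matrix_inv L ** (K + L)"
    by (simp add: matrix_add_ldistrib inv add.commute)
  then have d: "det (mat 1 + matrix_inv L ** K) = det (K + L) / det L"
    by (simp add: det_mul di)
  let ?c = "sqrt (2 * pi) ^ CARD('n)"
  have c: "0 < ?c" "0 < sqrt (det L)" "0 < sqrt (det (K + L))"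
    using det_pos_def[OF L] det_pos_def[OF KL] by simp_all
  have half: "log 2 (sqrt x) = 1/2 * log 2 x" if "0 < x" for x
    using that by (simp add: log_def ln_sqrt)
  have "log_gauss_mean L L - log_gauss_mean (K + L) (K + L) = log 2 (?c * sqrt (det (K + L))) - log 2 (?c * sqrt (det L))"
    by (simp only: log_gauss_mean_self L KL)
  also have "\<dots> = log 2 (sqrt (det (K + L))) - log 2 (sqrt (det L))"
    using c by (simp add: log_mult_pos)
  also have "\<dots> = 1/2 * log 2 (det (K + L) / det L)"
    using det_pos_def[OF L] det_pos_def[OF KL] by (simp add: half log_divide_pos)
  finally show ?thesis unfolding d .
qed

text \<open>Taking the actual covariances as references makes both bounds equal to \<open>v\<close>:
  Gaussian noise holds every input to at most \<open>v\<close>, and Gaussian input secures at least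
  \<open>v\<close> against every noise. This saddle point determines all three values.\<close>

lemma additive_info_saddle:
  fixes K L :: "real^'n^'n"
  assumes K: "psd K" and L: "pos_def L"
  defines "v \<equiv> ereal (1/2 * log 2 (det (mat 1 + matrix_inv L ** K)))"
  shows "(SUP P\<in>centered_laws K. additive_info P (gaussian L)) = v" "mu K L = v"
    "additive_info (gaussian K) (gaussian L) = v"
proof -
  note G = gaussian_in_centered_laws[OF K] gaussian_in_centered_laws[OF pos_def_imp_psd[OF L]]
  have lower: "v \<le> additive_info (gaussian K) Q" if "Q \<in> centered_laws L" for Q
    using additive_info_gaussian_input_ge[OF K L that] by (simp only: log_gauss_mean_diff K L v_def)
  have upper: "additive_info P (gaussian L) \<le> v" if "P \<in> centered_laws K" for P
    using additive_info_gaussian_noise_le[OF that L psd_add_pos_def[OF K L]]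
    by (simp only: log_gauss_mean_diff K L v_def)
  show info: "additive_info (gaussian K) (gaussian L) = v"
    by (intro antisym lower upper G)
  show sup: "(SUP P\<in>centered_laws K. additive_info P (gaussian L)) = v"
    by (intro antisym SUP_least upper SUP_upper2[OF G(1)] lower G(2))
  show "mu K L = v"
    unfolding mu_def
  proof (rule antisym)
    show "(INF Q\<in>centered_laws L. SUP P\<in>centered_laws K. additive_info P Q) \<le> v"
      by (rule INF_lower2[OF G(2)]) (simp add: sup)
    show "v \<le> (INF Q\<in>centered_laws L. SUP P\<in>centered_laws K. additive_info P Q)"
      by (intro INF_greatest SUP_upper2[OF G(1)] lower)
  qed
qed

section \<open>Scalar covariances under trace constraints\<close>

lemma transpose_scaled_identity: "transpose (a *\<^sub>R mat 1) = a *\<^sub>R (mat 1 :: real^'n^'n)"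
  by (auto simp: transpose_def mat_def vec_eq_iff)

lemma psd_scaled_identity: "0 \<le> a \<Longrightarrow> psd (a *\<^sub>R (mat 1 :: real^'n^'n))"
  by (simp add: psd_def transpose_scaled_identity flip: scaleR_matrix_vector_assoc)

lemma pos_def_scaled_identity: "0 < a \<Longrightarrow> pos_def (a *\<^sub>R (mat 1 :: real^'n^'n))"
  by (simp add: pos_def_def transpose_scaled_identity flip: scaleR_matrix_vector_assoc)

lemma scaled_identity_mult: "(a *\<^sub>R mat 1) ** M = a *\<^sub>R M" for M :: "real^'n^'n"
  by (simp add: vec_eq_iff matrix_matrix_mult_def mat_def if_distrib if_distribR cong: if_cong)

text \<open>With a scalar reference the actual covariance enters only through its trace, the
  quantity that the constraint sets bound.\<close>

lemma log_gauss_mean_scaled_identity: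
  fixes M :: "real^'n^'n"
  assumes "0 < a"
  shows "log_gauss_mean (a *\<^sub>R mat 1) M =
    - log 2 (sqrt (2 * pi) ^ CARD('n) * sqrt (det (a *\<^sub>R (mat 1 :: real^'n^'n)))) - trace M / (2 * a * ln 2)"
proof -
  let ?A = "a *\<^sub>R mat 1 :: real^'n^'n"
  have inv: "invertible ?A" by (rule pos_def_invertible[OF pos_def_scaled_identity[OF assms]])
  have "?A ** ((1 / a) *\<^sub>R mat 1) = mat 1"
    using assms by (simp add: scaled_identity_mult)
  then have "matrix_inv ?A = matrix_inv ?A ** ?A ** ((1 / a) *\<^sub>R mat 1)"
    by (simp flip: matrix_mul_assoc)
  then have "matrix_inv ?A = (1 / a) *\<^sub>R mat 1"
    by (simp add: matrix_inv_cancel[OF inv])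
  then show ?thesis
    by (simp add: log_gauss_mean_def scaled_identity_mult trace_scaleR mult_ac)
qed

text \<open>The references stay at the scalar pair while the competitor varies. A smaller input
  trace only lowers the upper bound. A noise trace below the budget raises the noise term in
  proportion to \<open>1 / \<sigma>\<^sup>2\<close>, while the output contribution falls only in
  proportion to \<open>1 / (\<Delta>\<^sup>2 + \<sigma>\<^sup>2)\<close>. The competitor
  \<open>L\<close> may be singular.\<close>

lemma scaled_identity_worst_case:
  fixes \<Delta> \<sigma> :: real
  assumes "0 < \<Delta>" "0 < \<sigma>"
  defines "KX0 \<equiv> \<Delta>\<^sup>2 *\<^sub>R (mat 1 :: real^'n^'n)" and "KY0 \<equiv> \<sigma>\<^sup>2 *\<^sub>R (mat 1 :: real^'n^'n)"
  shows "K \<in> psd_trace_le (CARD('n) * \<Delta>\<^sup>2) \<Longrightarrow> mu K KY0 \<le> mu KX0 KY0"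
    and "L \<in> psd_trace_le (CARD('n) * \<sigma>\<^sup>2) \<Longrightarrow> mu KX0 KY0 \<le> mu KX0 L"
proof -
  have D: "0 < \<Delta>\<^sup>2" and S: "0 < \<sigma>\<^sup>2" and DS: "0 < \<Delta>\<^sup>2 + \<sigma>\<^sup>2" using assms by (auto intro: add_pos_pos)
  have X: "psd KX0" and Y: "pos_def KY0"
    unfolding KX0_def KY0_def using D S by (auto intro: psd_scaled_identity pos_def_scaled_identity)
  have sum: "KX0 + KY0 = (\<Delta>\<^sup>2 + \<sigma>\<^sup>2) *\<^sub>R mat 1"
    by (simp add: KX0_def KY0_def scaleR_add_left)
  have \<Sigma>: "pos_def (KX0 + KY0)" by (rule psd_add_pos_def[OF X Y])
  have tr: "trace KX0 = CARD('n) * \<Delta>\<^sup>2" "trace KY0 = CARD('n) * \<sigma>\<^sup>2"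
    by (simp_all add: KX0_def KY0_def trace_scaleR trace_mat_1)
  have mu0: "mu KX0 KY0 = ereal (log_gauss_mean KY0 KY0 - log_gauss_mean (KX0 + KY0) (KX0 + KY0))"
    using additive_info_saddle(2)[OF X Y] by (simp only: log_gauss_mean_diff X Y)
  \<comment> \<open>The value at covariance 0 names the part of the formula that is independent of
    \<open>M\<close>.\<close>
  have mY: "log_gauss_mean KY0 M = log_gauss_mean KY0 0 - trace M / (2 * \<sigma>\<^sup>2 * ln 2)" for M
    unfolding KY0_def log_gauss_mean_scaled_identity[OF S] by (simp add: trace_def)
  have mS: "log_gauss_mean (KX0 + KY0) M = log_gauss_mean (KX0 + KY0) 0 - trace M / (2 * (\<Delta>\<^sup>2 + \<sigma>\<^sup>2) * ln 2)" for M
    unfolding sum log_gauss_mean_scaled_identity[OF DS] by (simp add: trace_def)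
  show "mu K KY0 \<le> mu KX0 KY0" if K: "K \<in> psd_trace_le (CARD('n) * \<Delta>\<^sup>2)"
  proof -
    have "trace (K + KY0) \<le> trace (KX0 + KY0)"
      using K by (simp add: psd_trace_le_def trace_add tr)
    then have "trace (K + KY0) / (2 * (\<Delta>\<^sup>2 + \<sigma>\<^sup>2) * ln 2) \<le> trace (KX0 + KY0) / (2 * (\<Delta>\<^sup>2 + \<sigma>\<^sup>2) * ln 2)"
      using DS by (intro divide_right_mono) auto
    then have le: "log_gauss_mean (KX0 + KY0) (KX0 + KY0) \<le> log_gauss_mean (KX0 + KY0) (K + KY0)"
      using mS[of "K + KY0"] mS[of "KX0 + KY0"] by linarith
    have "additive_info P (gaussian KY0) \<le> mu KX0 KY0" if "P \<in> centered_laws K" for P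
      unfolding mu0 by (rule order_trans[OF additive_info_gaussian_noise_le[OF that Y \<Sigma>]]) (simp add: le)
    then show ?thesis
      unfolding mu_def[of K]
      by (intro INF_lower2[OF gaussian_in_centered_laws[OF pos_def_imp_psd[OF Y]]] SUP_least)
  qed
  show "mu KX0 KY0 \<le> mu KX0 L" if L: "L \<in> psd_trace_le (CARD('n) * \<sigma>\<^sup>2)"
  proof -
    \<comment> \<open>\<open>t\<close> is the unspent part of the noise trace budget. Since it is
      nonnegative, the claim reduces to comparing its two coefficients.\<close>
    define t where "t = trace KY0 - trace L"
    have "0 \<le> t" using L by (simp add: psd_trace_le_def tr t_def)
    have "t / (2 * (\<Delta>\<^sup>2 + \<sigma>\<^sup>2) * ln 2) \<le> t / (2 * \<sigma>\<^sup>2 * ln 2)"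
      by (intro divide_left_mono mult_right_mono mult_pos_pos) (use D S DS \<open>0 \<le> t\<close> in auto)
    moreover have "trace (KX0 + KY0) / (2 * (\<Delta>\<^sup>2 + \<sigma>\<^sup>2) * ln 2) - trace (KX0 + L) / (2 * (\<Delta>\<^sup>2 + \<sigma>\<^sup>2) * ln 2) =
        t / (2 * (\<Delta>\<^sup>2 + \<sigma>\<^sup>2) * ln 2)"
      by (simp add: trace_add t_def flip: diff_divide_distrib)
    moreover have "trace KY0 / (2 * \<sigma>\<^sup>2 * ln 2) - trace L / (2 * \<sigma>\<^sup>2 * ln 2) = t / (2 * \<sigma>\<^sup>2 * ln 2)"
      by (simp add: t_def diff_divide_distrib)
    ultimately have "log_gauss_mean KY0 KY0 - log_gauss_mean (KX0 + KY0) (KX0 + KY0) \<le>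
        log_gauss_mean KY0 L - log_gauss_mean (KX0 + KY0) (KX0 + L)"
      using mY[of KY0] mY[of L] mS[of "KX0 + KY0"] mS[of "KX0 + L"] by linarith
    then have "mu KX0 KY0 \<le> additive_info (gaussian KX0) Q" if "Q \<in> centered_laws L" for Q
      unfolding mu0 by (intro order_trans[OF _ additive_info_gaussian_input_ge[OF X Y that]]) simp
    then show ?thesis
      unfolding mu_def[of _ L]
      by (intro INF_greatest SUP_upper2[OF gaussian_in_centered_laws[OF X]])
  qed
qed

theorem theorem3:
  fixes \<Delta> \<sigma> :: real
  assumes "0 < \<Delta>" "0 < \<sigma>"
  shows
    "(\<forall>KX KY :: real^'n^'n. psd KX \<longrightarrow> pos_def KY \<longrightarrow>
        gaussian KX \<in> centered_laws KX \<and>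
        gaussian KY \<in> centered_laws KY \<and>
        (SUP PX\<in>centered_laws KX. additive_info PX (gaussian KY)) = mu KX KY \<and>
        additive_info (gaussian KX) (gaussian KY) =
          (SUP PX\<in>centered_laws KX. additive_info PX (gaussian KY)) \<and>
        mu KX KY = ereal (1/2 * log 2 (det (mat 1 + matrix_inv KY ** KX)))) \<and>
     (let d = real CARD('n);
          Id = (mat 1 :: real^'n^'n);
          KKX = (psd_trace_le (d * \<Delta>\<^sup>2) :: (real^'n^'n) set);
          KKY = (psd_trace_le (d * \<sigma>\<^sup>2) :: (real^'n^'n) set)
      in \<Delta>\<^sup>2 *\<^sub>R Id \<in> KKX \<and>
         \<sigma>\<^sup>2 *\<^sub>R Id \<in> KKY \<and>
         (SUP KX\<in>KKX. mu KX (\<sigma>\<^sup>2 *\<^sub>R Id)) = (INF KY\<in>KKY. SUP KX\<in>KKX. mu KX KY) \<and>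
         mu (\<Delta>\<^sup>2 *\<^sub>R Id) (\<sigma>\<^sup>2 *\<^sub>R Id) = (SUP KX\<in>KKX. mu KX (\<sigma>\<^sup>2 *\<^sub>R Id)))"
proof -
  let ?KX = "\<Delta>\<^sup>2 *\<^sub>R (mat 1 :: real^'n^'n)" and ?KY = "\<sigma>\<^sup>2 *\<^sub>R (mat 1 :: real^'n^'n)"
  let ?KKX = "psd_trace_le (real CARD('n) * \<Delta>\<^sup>2) :: (real^'n^'n) set"
  let ?KKY = "psd_trace_le (real CARD('n) * \<sigma>\<^sup>2) :: (real^'n^'n) set"
  note worst = scaled_identity_worst_case[OF assms, where 'n='n]
  have mem: "?KX \<in> ?KKX" "?KY \<in> ?KKY"
    by (simp_all add: psd_trace_le_def psd_scaled_identity trace_scaleR trace_mat_1)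
  have sup: "(SUP KX\<in>?KKX. mu KX ?KY) = mu ?KX ?KY"
    by (intro antisym SUP_least worst(1) SUP_upper mem)
  \<comment> \<open>Choosing \<open>?KY\<close> gives the upper bound; answering every noise
    covariance with \<open>?KX\<close> gives the lower bound.\<close>
  have "(INF KY\<in>?KKY. SUP KX\<in>?KKX. mu KX KY) = mu ?KX ?KY"
  proof (rule antisym)
    show "(INF KY\<in>?KKY. SUP KX\<in>?KKX. mu KX KY) \<le> mu ?KX ?KY"
      by (rule INF_lower2[OF mem(2)]) (simp add: sup)
    show "mu ?KX ?KY \<le> (INF KY\<in>?KKY. SUP KX\<in>?KKX. mu KX KY)"
      by (intro INF_greatest SUP_upper2[OF mem(1)] worst(2))
  qed
  with sup mem show ?thesis
    unfolding Let_def
    by (auto simp: additive_info_saddle gaussian_in_centered_laws pos_def_imp_psd)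
qed

end
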